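(* Let $X_1,\dots,X_n$ be an independent sample from a density $f\in\mathcal{F}_0$ on the one-dimensional tree space $\mathcal{T}_3$, with $n\ge 2$. Then, with probability one, a maximum likelihood estimator $\hat f_n$ of $f$ in $\mathcal{F}_0$ exists and is unique, i.e. there is a unique maximizer $\hat f_n\in\mathcal{F}_0$ of the log-likelihood $l(g)=\sum_{i=1}^n\log g(X_i)$ over $g\in\mathcal{F}_0$.
   Context: $\mathcal{T}_3$ (the BHV tree space of metric 3-trees) is the metric space obtained by gluing three closed half-lines $O_1,O_2,O_3\cong\mathbb{R}_{\ge 0}$ at their common endpoint $0$ (the origin); the distance between points in the same half-line is the absolute difference of coordinates, and between $x\in O_i$, $y\in O_j$ with $i\ne j$ it is $d(x,0)+d(0,y)$. It is a Hadamard (CAT(0)) space. The base measure $\nu$ on $\mathcal{T}_3$ is the sum of the Lebesgue measures on the three open half-lines (the origin has measure zero), completed. Geodesics, convex sets and concave functions are as in a Hadamard space: $(1-\lambda)x+\lambda y$ is the point on the unique geodesic from $x$ to $y$ at distance $\lambda d(x,y)$ from $x$; a function $\phi:\mathcal{T}_3\to[-\infty,\infty]$ is concave if its hypograph $\{(x,\mu):\mu\le\phi(x)\}$ is a convex subset of $\mathcal{T}_3\times\mathbb{R}$ (i.e. contains the geodesic between any two of its points). A density $g\ge 0$ with $\int g\,d\nu=1$ is log-concave if $\log g$ (with $\log 0=-\infty$) is concave. $\mathcal{F}_0$ denotes the set of log-concave probability densities with respect to $\nu$ on $\mathcal{T}_3$. *)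

theory Defs
  imports "HOL-Probability.Probability"
begin

text \<open>The tree space T3: three half-lines (branches 0,1,2) glued at the origin.
  A point is represented by (branch index, distance to origin); the origin is (0,0).\<close>

typedef t3 = "{(i::nat, r::real). (i < 3 \<and> 0 < r) \<or> (i = 0 \<and> r = 0)}"
  by auto

definition t3_origin :: t3 where
  "t3_origin = Abs_t3 (0, 0)"

definition pt :: "nat \<Rightarrow> real \<Rightarrow> t3" where
  "pt i r = (if 0 < r \<and> i < 3 then Abs_t3 (i, r) else t3_origin)"

definition branch :: "t3 \<Rightarrow> nat" where
  "branch x = fst (Rep_t3 x)"

definition rad :: "t3 \<Rightarrow> real" where
  "rad x = snd (Rep_t3 x)"

definition t3_dist :: "t3 \<Rightarrow> t3 \<Rightarrow> real" where
  "t3_dist x y = (if branch x = branch y then \<bar>rad x - rad y\<bar> else rad x + rad y)"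

text \<open>geod x y l = (1-l)x + l y: the point on the unique geodesic from x to y
  at distance l * d(x,y) from x.\<close>
definition geod :: "t3 \<Rightarrow> t3 \<Rightarrow> real \<Rightarrow> t3" where
  "geod x y l =
     (if branch x = branch y then pt (branch x) ((1 - l) * rad x + l * rad y)
      else (let t = l * (rad x + rad y) in
            if t \<le> rad x then pt (branch x) (rad x - t) else pt (branch y) (t - rad x)))"

text \<open>Concavity: the hypograph {(x,mu). mu <= phi x} (mu real) is a convex subset
  of T3 x R, geodesics in the product being pairs of geodesics with the same parameter.\<close>
definition concave_t3 :: "(t3 \<Rightarrow> ereal) \<Rightarrow> bool" where
  "concave_t3 \<phi> \<longleftrightarrow>
     (\<forall>x y (\<mu>::real) (\<eta>::real) (l::real).
        ereal \<mu> \<le> \<phi> x \<longrightarrow> ereal \<eta> \<le> \<phi> y \<longrightarrow> 0 \<le> l \<longrightarrow> l \<le> 1 \<longrightarrow>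
        ereal ((1 - l) * \<mu> + l * \<eta>) \<le> \<phi> (geod x y l))"

text \<open>The base measure nu: sum of Lebesgue measures on the three open half-lines,
  completed (measurable sets = sets whose trace on each open branch is Lebesgue measurable).\<close>
definition nu :: "t3 measure" where
  "nu = measure_of UNIV
     {A. \<forall>i<3. {r::real. 0 < r \<and> pt i r \<in> A} \<in> sets lebesgue}
     (\<lambda>A. \<Sum>i<3. emeasure lebesgue {r::real. 0 < r \<and> pt i r \<in> A})"

definition elog :: "real \<Rightarrow> ereal" where
  "elog u = (if u = 0 then -\<infinity> else ereal (ln u))"

definition F0 :: "(t3 \<Rightarrow> real) set" where
  "F0 = {g. (\<forall>x. 0 \<le> g x) \<and> g \<in> borel_measurable nu \<and>
            (\<integral>\<^sup>+ x. ennreal (g x) \<partial>nu) = 1 \<and> concave_t3 (\<lambda>x. elog (g x))}"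

definition loglik :: "nat \<Rightarrow> (t3 \<Rightarrow> real) \<Rightarrow> (nat \<Rightarrow> t3) \<Rightarrow> ereal" where
  "loglik n g xs = (\<Sum>i<n. elog (g (xs i)))"

end

theory Submission
  imports Defs "HOL-Real_Asymp.Real_Asymp"
begin

text \<open>
  Existence: integrating along geodesics shows that a log-concave density whose likelihood is not
  small has bounded values at the sample points, so a maximizing sequence can be chosen whose
  values at the sample points converge. The pointwise lower limit of log-concave functions is
  log-concave, and by Fatou's lemma its integral is at most one; normalising it gives a maximizer.

  Uniqueness: the normalised geometric mean of two maximizers would have a larger likelihood unless
  they agree almost everywhere. Two log-concave functions that agree almost everywhere agree inside
  every geodesic on which they are positive. At a sample point the smaller of the two values could
  be raised to the larger one without destroying log-concavity. A maximizer vanishes at every other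
  point that is not strictly between two sample points, since restricting it to a suitable convex
  set containing the sample would otherwise increase the likelihood.
\<close>

subsection \<open>Lines in the tree space\<close>

lemma branch_pt: "0 < r \<Longrightarrow> i < 3 \<Longrightarrow> branch (pt i r) = i"
  and rad_pt: "0 < r \<Longrightarrow> i < 3 \<Longrightarrow> rad (pt i r) = r"
  by (auto simp: branch_def rad_def pt_def Abs_t3_inverse)

lemma pt_nonpos: "r \<le> 0 \<Longrightarrow> pt i r = t3_origin"
  by (auto simp: pt_def)

lemma branch_origin [simp]: "branch t3_origin = 0"
  and rad_origin [simp]: "rad t3_origin = 0"
  by (auto simp: branch_def rad_def t3_origin_def Abs_t3_inverse)

lemma t3_cases:
  obtains "x = t3_origin" | i r where "i < 3" "0 < r" "x = pt i r"
proof (cases x)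
  case (Abs_t3 y)
  then show ?thesis using that by (cases y) (auto simp: pt_def t3_origin_def split: if_splits)
qed

lemma rad_nonneg [simp]: "0 \<le> rad x"
  by (cases x rule: t3_cases) (auto simp: rad_pt)

lemma branch_less [simp]: "branch x < 3"
  by (cases x rule: t3_cases) (auto simp: branch_pt)

lemma pt_branch_rad: "pt (branch x) (rad x) = x"
  by (cases x rule: t3_cases) (auto simp: branch_pt rad_pt pt_nonpos)

lemma rad_eq_0_iff: "rad x = 0 \<longleftrightarrow> x = t3_origin"
  by (cases x rule: t3_cases) (auto simp: rad_pt dest: arg_cong[where f=rad])

definition line_pt :: "nat \<Rightarrow> nat \<Rightarrow> real \<Rightarrow> t3" where
  "line_pt i j r = (if 0 \<le> r then pt i r else pt j (- r))"

lemma geod_pt_same: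
  assumes "i < 3" "0 \<le> a" "0 \<le> b" "0 \<le> l" "l \<le> 1"
  shows "geod (pt i a) (pt i b) l = pt i ((1 - l) * a + l * b)"
proof -
  consider "a = 0" "b = 0" | "a = 0" "0 < b" | "0 < a" "b = 0" | "0 < a" "0 < b"
    using assms by linarith
  then show ?thesis
  proof cases
    case 2
    then show ?thesis using assms
      by (auto simp: geod_def branch_pt rad_pt pt_nonpos Let_def mult_le_0_iff)
  next
    case 3
    then show ?thesis using assms
      by (auto simp: geod_def branch_pt rad_pt pt_nonpos Let_def algebra_simps mult_left_le)
  qed (use assms in \<open>auto simp: geod_def branch_pt rad_pt pt_nonpos\<close>)
qed

lemma geod_pt_diff:
  assumes "i < 3" "j < 3" "i \<noteq> j" "0 \<le> a" "0 \<le> b" "0 \<le> l" "l \<le> 1"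
  shows "geod (pt i a) (pt j b) l =
    (if l * (a + b) \<le> a then pt i (a - l * (a + b)) else pt j (l * (a + b) - a))"
proof (cases "0 < a \<and> 0 < b")
  case True
  then show ?thesis using assms by (auto simp: geod_def branch_pt rad_pt Let_def)
next
  case False
  then consider "a = 0" | "0 < a" "b = 0" using assms by linarith
  then show ?thesis
  proof cases
    case 1
    then have "geod (pt i a) (pt j b) l = geod (pt j 0) (pt j b) l" by (simp add: pt_nonpos)
    also have "\<dots> = pt j (l * b)" using assms by (subst geod_pt_same) auto
    finally show ?thesis using 1 assms by (auto simp: pt_nonpos mult_le_0_iff)
  next
    case 2
    then have "geod (pt i a) (pt j b) l = geod (pt i a) (pt i 0) l" by (simp add: pt_nonpos)
    also have "\<dots> = pt i ((1 - l) * a)" using assms 2 by (subst geod_pt_same) auto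
    finally show ?thesis using 2 assms by (auto simp: algebra_simps mult_left_le)
  qed
qed

lemma geod_line_pt:
  assumes "i < 3" "j < 3" "i \<noteq> j" "0 \<le> l" "l \<le> 1"
  shows "geod (line_pt i j a) (line_pt i j b) l = line_pt i j ((1 - l) * a + l * b)"
proof -
  consider "0 \<le> a" "0 \<le> b" | "a < 0" "b < 0" | "0 \<le> a" "b < 0" | "a < 0" "0 \<le> b" by linarith
  then show ?thesis
  proof cases
    case 1
    then have "0 \<le> (1 - l) * a + l * b" using assms by simp
    then show ?thesis using 1 assms by (simp add: line_pt_def geod_pt_same)
  next
    case 2
    have neg: "(1 - l) * a + l * b < 0"
      using 2 assms by (intro convex_bound_lt) auto
    have "geod (pt j (-a)) (pt j (-b)) l = pt j ((1 - l) * (-a) + l * (-b))"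
      by (rule geod_pt_same) (use 2 assms in auto)
    also have "\<dots> = pt j (- ((1 - l) * a + l * b))" by (simp add: algebra_simps)
    finally show ?thesis using neg 2 by (simp add: line_pt_def)
  next
    case 3
    have "geod (pt i a) (pt j (-b)) l = (if l * (a + -b) \<le> a then pt i (a - l * (a + -b)) else pt j (l * (a + -b) - a))"
      by (rule geod_pt_diff) (use 3 assms in auto)
    moreover have "(1 - l) * a + l * b = a - l * (a + -b)" by (simp add: algebra_simps)
    ultimately show ?thesis using 3 by (simp add: line_pt_def)
  next
    case 4
    have "geod (pt j (-a)) (pt i b) l = (if l * (-a + b) \<le> -a then pt j (-a - l * (-a + b)) else pt i (l * (-a + b) - -a))"
      by (rule geod_pt_diff) (use 4 assms in auto)
    moreover have "(1 - l) * a + l * b = l * (-a + b) - -a" by (simp add: algebra_simps)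
    ultimately show ?thesis using 4 by (auto simp: line_pt_def pt_nonpos algebra_simps)
  qed
qed

lemma other_branch: obtains j :: nat where "j < 3" "j \<noteq> k"
  by (rule that[of "if k = 0 then 1 else 0"]) (auto split: if_splits)

lemma common_line:
  obtains i j a b where "i < 3" "j < 3" "i \<noteq> j" "p = line_pt i j a" "q = line_pt i j b"
proof (cases "branch p = branch q")
  case True
  obtain j where "j < 3" "j \<noteq> branch p" by (rule other_branch)
  then show ?thesis
    using that[of "branch p" j "rad p" "rad q"] True
    by (metis branch_less line_pt_def pt_branch_rad rad_nonneg)
next
  case False
  have "q = line_pt (branch p) (branch q) (- rad q)"
    using pt_branch_rad[of q] by (cases "rad q = 0") (auto simp: line_pt_def pt_nonpos less_le)
  moreover have "p = line_pt (branch p) (branch q) (rad p)"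
    by (simp add: line_pt_def pt_branch_rad)
  ultimately show ?thesis using that False by (metis branch_less)
qed

lemma line_segment_branch:
  assumes "a < b"
  obtains k c d where "k = i \<or> k = j" "0 \<le> c" "c < d"
    "\<And>r. c < r \<Longrightarrow> r < d \<Longrightarrow> \<exists>t. a < t \<and> t < b \<and> pt k r = line_pt i j t"
proof (cases "0 < b")
  case True
  have "\<exists>t. a < t \<and> t < b \<and> pt i r = line_pt i j t" if "max a 0 < r" "r < b" for r
    using that by (intro exI[of _ r]) (auto simp: line_pt_def)
  then show ?thesis using that[of i "max a 0" b] True assms by auto
next
  case False
  have "\<exists>t. a < t \<and> t < b \<and> pt j r = line_pt i j t" if "-b < r" "r < -a" for r
    using that False by (intro exI[of _ "-r"]) (auto simp: line_pt_def)
  then show ?thesis using that[of j "-b" "-a"] False assms by auto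
qed

subsection \<open>The base measure\<close>

lemma sigma_algebra_t3:
  "sigma_algebra UNIV {A. \<forall>i<3. {r::real. 0 < r \<and> pt i r \<in> A} \<in> sets lebesgue}"
    (is "sigma_algebra _ ?S")
  unfolding sigma_algebra_iff2
proof (intro conjI ballI allI impI)
  fix A assume A: "A \<in> ?S"
  have "{r::real. 0 < r \<and> pt i r \<in> UNIV - A} = {0<..} - {r. 0 < r \<and> pt i r \<in> A}" for i by auto
  then show "UNIV - A \<in> ?S" using A by auto
next
  fix A :: "nat \<Rightarrow> t3 set" assume A: "range A \<subseteq> ?S"
  have "{r::real. 0 < r \<and> pt i r \<in> (\<Union>n. A n)} = (\<Union>n. {r. 0 < r \<and> pt i r \<in> A n})" for i by auto
  moreover have "{r. 0 < r \<and> pt i r \<in> A n} \<in> sets lebesgue" if "i < 3" for i n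
    using A that by auto
  ultimately show "(\<Union>n. A n) \<in> ?S" by auto
qed auto

lemma space_nu [simp]: "space nu = UNIV"
  by (simp add: nu_def)

lemma sets_nu: "sets nu = {A. \<forall>i<3. {r::real. 0 < r \<and> pt i r \<in> A} \<in> sets lebesgue}"
  unfolding nu_def using sigma_algebra.sets_measure_of_eq[OF sigma_algebra_t3] by auto

lemma emeasure_nu:
  assumes "A \<in> sets nu"
  shows "emeasure nu A = (\<Sum>i<3. emeasure lebesgue {r::real. 0 < r \<and> pt i r \<in> A})"
proof -
  let ?S = "{A. \<forall>i<3. {r::real. 0 < r \<and> pt i r \<in> A} \<in> sets lebesgue}"
  let ?m = "\<lambda>A. \<Sum>i<3. emeasure lebesgue {r::real. 0 < r \<and> pt i r \<in> A}"
  have "countably_additive ?S ?m"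
  proof (rule countably_additiveI)
    fix A :: "nat \<Rightarrow> t3 set"
    assume A: "range A \<subseteq> ?S" and d: "disjoint_family A"
    have "(\<Sum>n. emeasure lebesgue {r::real. 0 < r \<and> pt i r \<in> A n})
        = emeasure lebesgue {r::real. 0 < r \<and> pt i r \<in> (\<Union>n. A n)}" if "i < 3" for i
    proof -
      have "{r::real. 0 < r \<and> pt i r \<in> (\<Union>n. A n)} = (\<Union>n. {r. 0 < r \<and> pt i r \<in> A n})" by auto
      moreover have "range (\<lambda>n. {r. 0 < r \<and> pt i r \<in> A n}) \<subseteq> sets lebesgue"
        using A that by auto
      moreover have "disjoint_family (\<lambda>n. {r. 0 < r \<and> pt i r \<in> A n})"
        using d by (auto simp: disjoint_family_on_def)
      ultimately show ?thesis by (metis suminf_emeasure)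
    qed
    then show "(\<Sum>n. ?m (A n)) = ?m (\<Union>n. A n)"
      by (subst suminf_sum) auto
  qed
  moreover have "positive ?S ?m" by (auto simp: positive_def)
  ultimately show ?thesis
    using emeasure_measure_of_sigma[OF sigma_algebra_t3] assms
    unfolding sets_nu unfolding nu_def by blast
qed

lemma sets_nu_rad_branch: "{x. branch x = i \<and> P (rad x)} \<in> sets nu"
  if "{r. P r} \<in> sets borel" for i and P :: "real \<Rightarrow> bool"
proof -
  have "{r. 0 < r \<and> pt k r \<in> {x. branch x = i \<and> P (rad x)}}
    = (if k = i then {0<..} \<inter> {r. P r} else {})" if "k < 3" for k
    using that by (auto simp: branch_pt rad_pt)
  moreover have "{0<..} \<inter> {r. P r} \<in> sets lebesgue" using that by auto
  ultimately show ?thesis unfolding sets_nu by auto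
qed

lemma rad_measurable [measurable]: "rad \<in> borel_measurable nu"
proof (rule measurableI)
  fix B :: "real set" assume B: "B \<in> sets borel"
  have "rad -` B \<inter> space nu = (\<Union>i<3. {x. branch x = i \<and> rad x \<in> B})" by auto
  moreover have "{x. branch x = i \<and> rad x \<in> B} \<in> sets nu" for i
    by (rule sets_nu_rad_branch) (use B in auto)
  ultimately show "rad -` B \<inter> space nu \<in> sets nu" by auto
qed simp

lemma rad_fibre_null: "{x. rad x = s} \<in> null_sets nu"
proof -
  have s: "{x. rad x = s} \<in> sets nu"
    using measurable_sets[OF rad_measurable, of "{s}"] by (simp add: vimage_def)
  have "emeasure lebesgue {r. 0 < r \<and> pt i r \<in> {x. rad x = s}} = 0" if "i < 3" for i
  proof -
    have "{r. 0 < r \<and> pt i r \<in> {x. rad x = s}} \<subseteq> {s}" using that by (auto simp: rad_pt)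
    from subset_singletonD[OF this] show ?thesis
      by (elim disjE) (simp_all only: emeasure_empty emeasure_lborel_singleton, simp)
  qed
  then show ?thesis using s by (auto simp: null_sets_def emeasure_nu)
qed

lemma singleton_null: "{p} \<in> null_sets nu"
proof -
  have "{p} = {x. branch x = branch p \<and> rad x = rad p}"
    using pt_branch_rad by (auto, metis)
  moreover have "{x. branch x = branch p \<and> rad x = rad p} \<in> sets nu"
    by (rule sets_nu_rad_branch) simp
  ultimately have "{p} \<in> sets nu" by simp
  then show ?thesis by (rule null_sets_subset[OF rad_fibre_null[of "rad p"]]) simp
qed

lemma emeasure_branch_segment:
  assumes "k < 3" "0 \<le> c" "c < d"
  shows "{x. branch x = k \<and> c < rad x \<and> rad x < d} \<in> sets nu" (is "?A \<in> _")
    and "emeasure nu {x. branch x = k \<and> c < rad x \<and> rad x < d} = ennreal (d - c)"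
proof -
  show A: "?A \<in> sets nu"
    using sets_nu_rad_branch[of "\<lambda>r. c < r \<and> r < d" k] by simp
  have "{r. 0 < r \<and> pt i r \<in> ?A} = (if i = k then {c<..<d} else {})" if "i < 3" for i
    using that assms by (auto simp: rad_pt branch_pt)
  then have "emeasure nu ?A = (\<Sum>i<3. emeasure lebesgue (if i = k then {c<..<d} else {}))"
    unfolding emeasure_nu[OF A] by (intro sum.cong) auto
  also have "\<dots> = (\<Sum>i<3. if i = k then ennreal (d - c) else 0)"
    by (intro sum.cong) (use assms in auto)
  finally show "emeasure nu ?A = ennreal (d - c)" using assms by simp
qed

subsection \<open>Log-concave functions\<close>

definition log_concave :: "(t3 \<Rightarrow> real) \<Rightarrow> bool" where
  "log_concave g \<longleftrightarrow> (\<forall>x y l. 0 \<le> l \<longrightarrow> l \<le> 1 \<longrightarrow> 0 < g x \<longrightarrow> 0 < g y \<longrightarrow>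
     g x powr (1 - l) * g y powr l \<le> g (geod x y l))"

lemma ereal_le_elog_iff: "0 \<le> u \<Longrightarrow> ereal m \<le> elog u \<longleftrightarrow> exp m \<le> u"
  by (auto simp: elog_def ln_ge_iff)

lemma concave_elog_iff:
  assumes "\<And>x. 0 \<le> g x"
  shows "concave_t3 (\<lambda>x. elog (g x)) \<longleftrightarrow> log_concave g"
proof -
  have "concave_t3 (\<lambda>x. elog (g x)) \<longleftrightarrow> (\<forall>x y \<mu> \<eta> l. exp \<mu> \<le> g x \<longrightarrow> exp \<eta> \<le> g y \<longrightarrow>
      0 \<le> l \<longrightarrow> l \<le> 1 \<longrightarrow> exp ((1 - l) * \<mu> + l * \<eta>) \<le> g (geod x y l))"
    by (simp add: concave_t3_def ereal_le_elog_iff assms)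
  also have "\<dots> \<longleftrightarrow> log_concave g"
  proof
    assume *: "\<forall>x y \<mu> \<eta> l. exp \<mu> \<le> g x \<longrightarrow> exp \<eta> \<le> g y \<longrightarrow>
      0 \<le> l \<longrightarrow> l \<le> 1 \<longrightarrow> exp ((1 - l) * \<mu> + l * \<eta>) \<le> g (geod x y l)"
    show "log_concave g"
      unfolding log_concave_def
    proof (intro allI impI)
      fix x y and l :: real assume a: "0 \<le> l" "l \<le> 1" "0 < g x" "0 < g y"
      have "exp ((1 - l) * ln (g x) + l * ln (g y)) \<le> g (geod x y l)"
        using *[rule_format, of "ln (g x)" x "ln (g y)" y l] a by simp
      then show "g x powr (1 - l) * g y powr l \<le> g (geod x y l)"
        using a by (simp add: powr_def exp_add)
    qed
  next
    assume *: "log_concave g"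
    show "\<forall>x y \<mu> \<eta> l. exp \<mu> \<le> g x \<longrightarrow> exp \<eta> \<le> g y \<longrightarrow>
      0 \<le> l \<longrightarrow> l \<le> 1 \<longrightarrow> exp ((1 - l) * \<mu> + l * \<eta>) \<le> g (geod x y l)"
    proof (intro allI impI)
      fix x y and \<mu> \<eta> l :: real
      assume a: "exp \<mu> \<le> g x" "exp \<eta> \<le> g y" "0 \<le> l" "l \<le> 1"
      have pos: "0 < g x" "0 < g y" using a by (meson exp_gt_zero less_le_trans)+
      have "exp ((1 - l) * \<mu> + l * \<eta>) = exp \<mu> powr (1 - l) * exp \<eta> powr l"
        by (simp add: powr_def exp_add)
      also have "\<dots> \<le> g x powr (1 - l) * g y powr l"
        using a by (intro mult_mono powr_mono2) auto
      also have "\<dots> \<le> g (geod x y l)"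
        using * a pos by (simp add: log_concave_def)
      finally show "exp ((1 - l) * \<mu> + l * \<eta>) \<le> g (geod x y l)" .
    qed
  qed
  finally show ?thesis .
qed

lemma F0_iff: "g \<in> F0 \<longleftrightarrow> (\<forall>x. 0 \<le> g x) \<and> g \<in> borel_measurable nu \<and>
    (\<integral>\<^sup>+ x. ennreal (g x) \<partial>nu) = 1 \<and> log_concave g"
  unfolding F0_def using concave_elog_iff[of g] by auto

lemma F0_nonneg: "g \<in> F0 \<Longrightarrow> 0 \<le> g x"
  and F0_measurable: "g \<in> F0 \<Longrightarrow> g \<in> borel_measurable nu"
  and F0_integral: "g \<in> F0 \<Longrightarrow> (\<integral>\<^sup>+ x. ennreal (g x) \<partial>nu) = 1"
  and F0_log_concave: "g \<in> F0 \<Longrightarrow> log_concave g"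
  by (auto simp: F0_iff)

lemma geod_0 [simp]: "geod x y 0 = x"
  and geod_1 [simp]: "geod x y 1 = y"
proof -
  obtain i j a b where "i < 3" "j < 3" "i \<noteq> j" "x = line_pt i j a" "y = line_pt i j b"
    by (rule common_line)
  then show "geod x y 0 = x" "geod x y 1 = y" by (auto simp: geod_line_pt)
qed

lemma log_concaveI:
  assumes nn: "\<And>x. 0 \<le> g x"
    and "\<And>x y l. 0 < l \<Longrightarrow> l < 1 \<Longrightarrow> 0 < g x \<Longrightarrow> 0 < g y \<Longrightarrow> x \<noteq> y \<Longrightarrow>
      g x powr (1 - l) * g y powr l \<le> g (geod x y l)"
  shows "log_concave g"
  unfolding log_concave_def
proof (intro allI impI)
  fix x y and l :: real assume a: "0 \<le> l" "l \<le> 1" "0 < g x" "0 < g y"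
  consider "l = 0" | "l = 1" | "x = y" | "0 < l" "l < 1" "x \<noteq> y" using a by linarith
  then show "g x powr (1 - l) * g y powr l \<le> g (geod x y l)"
  proof cases
    case 3
    obtain i j b c where "i < 3" "j < 3" "i \<noteq> j" "x = line_pt i j b" "x = line_pt i j c"
      by (rule common_line[of x x])
    then have "geod x x l = x" using geod_line_pt[of i j l b b] a by (simp add: algebra_simps)
    then show ?thesis using 3 a by (simp flip: powr_add)
  qed (use a assms(2) in auto)
qed

lemma log_concaveD:
  "log_concave g \<Longrightarrow> 0 \<le> l \<Longrightarrow> l \<le> 1 \<Longrightarrow> 0 < g x \<Longrightarrow> 0 < g y \<Longrightarrow>
     g x powr (1 - l) * g y powr l \<le> g (geod x y l)"
  by (simp add: log_concave_def)

lemma log_concave_pos: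
  assumes "log_concave g" "0 \<le> l" "l \<le> 1" "0 < g x" "0 < g y"
  shows "0 < g (geod x y l)"
proof -
  have "0 < g x powr (1 - l) * g y powr l" using assms by simp
  then show ?thesis using log_concaveD[OF assms] by linarith
qed

lemma log_concave_pos_line:
  assumes g: "log_concave g" and ij: "i < 3" "j < 3" "i \<noteq> j"
    and pos: "0 < g (line_pt i j a)" "0 < g (line_pt i j b)" and t: "a \<le> t" "t \<le> b"
  shows "0 < g (line_pt i j t)"
proof (cases "a = b")
  case False
  define l where "l = (t - a) / (b - a)"
  have l: "0 \<le> l" "l \<le> 1" using t False by (auto simp: l_def field_simps)
  have "l * (b - a) = t - a" using False by (simp add: l_def)
  then have "(1 - l) * a + l * b = t" by (simp add: algebra_simps)
  then show ?thesis using log_concave_pos[OF g l pos] ij l by (simp add: geod_line_pt)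
qed (use pos t in auto)

lemma AE_dense_line:
  assumes "AE x in nu. P x" "a < b" "i < 3" "j < 3"
  obtains t where "a < t" "t < b" "P (line_pt i j t)"
proof -
  obtain k c d where k: "k = i \<or> k = j" "0 \<le> c" "c < d"
    and r: "\<And>r. c < r \<Longrightarrow> r < d \<Longrightarrow> \<exists>t. a < t \<and> t < b \<and> pt k r = line_pt i j t"
    using line_segment_branch[OF assms(2)] by metis
  have k3: "k < 3" using k assms by auto
  let ?S = "{x. branch x = k \<and> c < rad x \<and> rad x < d}"
  have "\<exists>x\<in>?S. P x"
  proof (rule ccontr)
    assume "\<not> (\<exists>x\<in>?S. P x)"
    then have "AE x in nu. x \<notin> ?S" using assms(1) by (auto elim!: eventually_mono)
    then have "emeasure nu ?S = 0"
      using emeasure_branch_segment(1)[OF k3 k(2,3)] by (subst (asm) AE_iff_measurable[where N="?S"]) auto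
    then show False using emeasure_branch_segment(2)[OF k3 k(2,3)] k by simp
  qed
  then obtain x where x: "branch x = k" "c < rad x" "rad x < d" "P x" by auto
  then show ?thesis using r[OF x(2,3)] pt_branch_rad[of x] that by metis
qed

lemma integral_ge_on_geodesic:
  assumes "p \<noteq> q" "0 < u" "u \<le> 1"
  obtains \<delta> :: real where "0 < \<delta>"
    "\<And>g v. 0 \<le> v \<Longrightarrow> (\<And>t. 0 < t \<Longrightarrow> t < u \<Longrightarrow> v \<le> g (geod p q t)) \<Longrightarrow>
      ennreal (\<delta> * v) \<le> (\<integral>\<^sup>+ x. ennreal (g x) \<partial>nu)"
proof -
  obtain i j a b where ij: "i < 3" "j < 3" "i \<noteq> j" and pq: "p = line_pt i j a" "q = line_pt i j b"
    by (rule common_line)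
  have ab: "a \<noteq> b" using pq assms by auto
  define m where "m = (1 - u) * a + u * b"
  have m: "m - a = u * (b - a)" by (simp add: m_def algebra_simps)
  then have "m \<noteq> a" using ab assms by auto
  then have "min a m < max a m" by auto
  then obtain k c d where k: "k = i \<or> k = j" "0 \<le> c" "c < d"
    and r: "\<And>r. c < r \<Longrightarrow> r < d \<Longrightarrow> \<exists>t. min a m < t \<and> t < max a m \<and> pt k r = line_pt i j t"
    using line_segment_branch by metis
  have k3: "k < 3" using k ij by auto
  have seg: "\<exists>t. 0 < t \<and> t < u \<and> x = geod p q t" if x: "branch x = k" "c < rad x" "rad x < d" for x
  proof -
    obtain s where s: "min a m < s" "s < max a m" "x = line_pt i j s"
      using r[OF x(2,3)] pt_branch_rad[of x] x(1) by metis
    define t where "t = (s - a) / (b - a)"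
    have t: "t * (b - a) = s - a" using ab by (simp add: t_def)
    have "0 < t \<and> t < u"
    proof (cases "a < b")
      case True
      then have "a < m" using m assms by (metis diff_gt_0_iff_gt mult_pos_pos)
      then have "0 < t * (b - a)" "t * (b - a) < u * (b - a)" using s t m by auto
      then show ?thesis using True by (auto simp: zero_less_mult_iff mult_less_cancel_right)
    next
      case False
      then have "b < a" using ab by simp
      then have "m < a" using m assms by (metis diff_less_0_iff_less mult_pos_neg)
      then have "t * (b - a) < 0" "u * (b - a) < t * (b - a)" using s t m by auto
      then show ?thesis using \<open>b < a\<close> by (auto simp: mult_less_0_iff mult_less_cancel_right)
    qed
    moreover have "(1 - t) * a + t * b = s" using t by (simp add: algebra_simps)
    ultimately show ?thesis using s ij assms pq by (intro exI[of _ t]) (auto simp: geod_line_pt)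
  qed
  let ?S = "{x. branch x = k \<and> c < rad x \<and> rad x < d}"
  note S = emeasure_branch_segment[OF k3 k(2,3)]
  show ?thesis
  proof (rule that[of "d - c"])
    show "0 < d - c" using k by simp
    fix g :: "t3 \<Rightarrow> real" and v :: real
    assume v: "0 \<le> v" "\<And>t. 0 < t \<Longrightarrow> t < u \<Longrightarrow> v \<le> g (geod p q t)"
    have "ennreal ((d - c) * v) = ennreal v * emeasure nu ?S"
      using S(2) v k by (simp add: ennreal_mult mult.commute)
    also have "\<dots> = (\<integral>\<^sup>+ x. ennreal v * indicator ?S x \<partial>nu)"
      using S(1) by (simp add: nn_integral_cmult_indicator)
    also have "\<dots> \<le> (\<integral>\<^sup>+ x. ennreal (g x) \<partial>nu)"
    proof (rule nn_integral_mono)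
      fix x
      show "ennreal v * indicator ?S x \<le> ennreal (g x)"
      proof (cases "x \<in> ?S")
        case True
        then obtain t where "0 < t" "t < u" "x = geod p q t" using seg by auto
        then show ?thesis using v True by (simp add: ennreal_leI)
      qed auto
    qed
    finally show "ennreal ((d - c) * v) \<le> (\<integral>\<^sup>+ x. ennreal (g x) \<partial>nu)" .
  qed
qed

lemma log_concave_integral_pos:
  assumes g: "log_concave g" and pos: "0 < g p" "0 < g q" and "p \<noteq> q"
  shows "0 < (\<integral>\<^sup>+ x. ennreal (g x) \<partial>nu)"
proof -
  obtain \<delta> :: real where \<delta>: "0 < \<delta>"
    "\<And>g v. 0 \<le> v \<Longrightarrow> (\<And>t. 0 < t \<Longrightarrow> t < 1 \<Longrightarrow> v \<le> g (geod p q t)) \<Longrightarrow>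
      ennreal (\<delta> * v) \<le> (\<integral>\<^sup>+ x. ennreal (g x) \<partial>nu)"
    using integral_ge_on_geodesic[OF \<open>p \<noteq> q\<close>, of 1] by auto
  define v where "v = min (g p) (g q)"
  have v: "0 < v" using pos by (simp add: v_def)
  have "v \<le> g (geod p q t)" if "0 < t" "t < 1" for t
  proof -
    have "v = v powr (1 - t) * v powr t" using v by (simp flip: powr_add)
    also have "\<dots> \<le> g p powr (1 - t) * g q powr t"
      using that v by (intro mult_mono powr_mono2) (auto simp: v_def)
    also have "\<dots> \<le> g (geod p q t)" using log_concaveD[OF g _ _ pos] that by simp
    finally show ?thesis .
  qed
  then have "ennreal (\<delta> * v) \<le> (\<integral>\<^sup>+ x. ennreal (g x) \<partial>nu)" using \<delta>(2)[of v g] v by simp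
  moreover have "0 < ennreal (\<delta> * v)" using v \<delta> by simp
  ultimately show ?thesis by (rule order.strict_trans2[rotated])
qed

text \<open>Integrate over the initial fraction 1/(n+1) of the geodesic from p to q: there the density
  is at least the geometric mean of its values at p and q with weights n/(n+1) and 1/(n+1).\<close>

lemma F0_values_bound:
  assumes "p \<noteq> q"
  obtains C :: real where "0 < C" "\<And>g. g \<in> F0 \<Longrightarrow> g q \<le> g p \<Longrightarrow> g p ^ n * g q \<le> C"
proof -
  define u where "u = 1 / real (Suc n)"
  have u: "0 < u" "u \<le> 1" by (auto simp: u_def)
  obtain \<delta> :: real where \<delta>: "0 < \<delta>"
    "\<And>g v. 0 \<le> v \<Longrightarrow> (\<And>t. 0 < t \<Longrightarrow> t < u \<Longrightarrow> v \<le> g (geod p q t)) \<Longrightarrow>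
      ennreal (\<delta> * v) \<le> (\<integral>\<^sup>+ x. ennreal (g x) \<partial>nu)"
    using integral_ge_on_geodesic[OF assms u] by metis
  show ?thesis
  proof (rule that[of "(1 / \<delta>) ^ Suc n"])
    show "0 < (1 / \<delta>) ^ Suc n" using \<delta> by simp
    fix g assume g: "g \<in> F0" and le: "g q \<le> g p"
    show "g p ^ n * g q \<le> (1 / \<delta>) ^ Suc n"
    proof (cases "g q = 0")
      case False
      then have pos: "0 < g q" "0 < g p" using F0_nonneg[OF g, of q] le by linarith+
      define v where "v = g p powr (1 - u) * g q powr u"
      have v0: "0 < v" using pos by (simp add: v_def)
      have "v \<le> g (geod p q t)" if t: "0 < t" "t < u" for t
      proof -
        have "v = g p powr (1 - u) * (g q powr (u - t) * g q powr t)"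
          unfolding v_def by (simp flip: powr_add)
        also have "\<dots> \<le> g p powr (1 - u) * (g p powr (u - t) * g q powr t)"
          using t pos le by (intro mult_left_mono mult_right_mono powr_mono2) auto
        also have "\<dots> = g p powr (1 - t) * g q powr t"
          by (simp flip: powr_add mult.assoc)
        also have "\<dots> \<le> g (geod p q t)"
          using log_concaveD[OF F0_log_concave[OF g] _ _ pos(2,1)] t u by simp
        finally show ?thesis .
      qed
      then have "ennreal (\<delta> * v) \<le> 1" using \<delta>(2)[of v g] v0 F0_integral[OF g] by simp
      then have "v \<le> 1 / \<delta>" using \<delta>(1) by (simp add: field_simps)
      then have "v ^ Suc n \<le> (1 / \<delta>) ^ Suc n" using v0 by (intro power_mono) auto
      moreover have "v ^ Suc n = g p ^ n * g q"
      proof -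
        have "v ^ Suc n = v powr real (Suc n)" using v0 by (simp only: powr_realpow)
        also have "\<dots> = g p powr ((1 - u) * real (Suc n)) * g q powr (u * real (Suc n))"
          unfolding v_def using pos by (simp add: powr_mult powr_powr)
        also have "(1 - u) * real (Suc n) = real n" by (simp add: u_def field_simps)
        also have "u * real (Suc n) = 1" by (simp add: u_def)
        finally show ?thesis using pos by (simp add: powr_realpow)
      qed
      ultimately show ?thesis by simp
    qed (use \<delta> in simp)
  qed
qed

subsection \<open>Existence of a maximizer\<close>

definition lik :: "nat \<Rightarrow> (t3 \<Rightarrow> real) \<Rightarrow> (nat \<Rightarrow> t3) \<Rightarrow> real" where
  "lik n g xs = (\<Prod>i<n. g (xs i))"

lemma elog_mult: "0 \<le> a \<Longrightarrow> 0 \<le> b \<Longrightarrow> elog (a * b) = elog a + elog b"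
  by (auto simp: elog_def ln_mult)

lemma elog_le_iff: "0 \<le> a \<Longrightarrow> 0 \<le> b \<Longrightarrow> elog a \<le> elog b \<longleftrightarrow> a \<le> b"
  by (auto simp: elog_def)

lemma lik_nonneg: "(\<And>x. 0 \<le> g x) \<Longrightarrow> 0 \<le> lik n g xs"
  by (simp add: lik_def prod_nonneg)

lemma loglik_eq_elog_lik:
  assumes "\<And>x. 0 \<le> g x"
  shows "loglik n g xs = elog (lik n g xs)"
proof (induction n)
  case (Suc n)
  have "0 \<le> (\<Prod>i<n. g (xs i))" using assms by (simp add: prod_nonneg)
  then show ?case using Suc assms by (simp add: loglik_def lik_def elog_mult)
qed (simp add: loglik_def lik_def elog_def zero_ereal_def)

lemma loglik_le_iff:
  "g \<in> F0 \<Longrightarrow> h \<in> F0 \<Longrightarrow> loglik n h xs \<le> loglik n g xs \<longleftrightarrow> lik n h xs \<le> lik n g xs"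
  by (simp add: loglik_eq_elog_lik elog_le_iff F0_nonneg lik_nonneg)

lemma lik_pos_imp: "(\<And>x. 0 \<le> g x) \<Longrightarrow> 0 < lik n g xs \<Longrightarrow> i < n \<Longrightarrow> 0 < g (xs i)"
  unfolding lik_def by (metis finite_lessThan less_eq_real_def lessThan_iff less_irrefl prod_zero)

lemma log_concave_divide:
  assumes "log_concave g" "0 < c"
  shows "log_concave (\<lambda>x. g x / c)"
  unfolding log_concave_def
proof (intro allI impI)
  fix x y and l :: real assume a: "0 \<le> l" "l \<le> 1" "0 < g x / c" "0 < g y / c"
  then have pos: "0 < g x" "0 < g y" using assms(2) by (auto simp: zero_less_divide_iff)
  have "(g x / c) powr (1 - l) * (g y / c) powr l
      = (g x powr (1 - l) * g y powr l) / (c powr (1 - l) * c powr l)"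
    using pos assms(2) by (simp add: powr_divide)
  also have "c powr (1 - l) * c powr l = c" using assms(2) by (simp flip: powr_add)
  finally show "(g x / c) powr (1 - l) * (g y / c) powr l \<le> g (geod x y l) / c"
    using log_concaveD[OF assms(1) a(1,2) pos] assms(2) by (simp add: divide_right_mono)
qed

lemma normalise_F0:
  assumes nn: "\<And>x. 0 \<le> h x" and [measurable]: "h \<in> borel_measurable nu"
    and "log_concave h" "(\<integral>\<^sup>+ x. ennreal (h x) \<partial>nu) = ennreal c" "0 < c"
  shows "(\<lambda>x. h x / c) \<in> F0"
proof -
  have "(\<integral>\<^sup>+ x. ennreal (h x / c) \<partial>nu) = (\<integral>\<^sup>+ x. ennreal (h x) / ennreal c \<partial>nu)"
    using nn assms(5) by (simp add: divide_ennreal)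
  also have "\<dots> = ennreal c / ennreal c"
    by (subst nn_integral_divide) (use assms in auto)
  also have "\<dots> = 1" using assms(5) by (simp add: divide_ennreal)
  finally show ?thesis
    using assms log_concave_divide[of h c] by (auto simp: F0_iff)
qed

lemma bounded_family_subseq:
  fixes u :: "nat \<Rightarrow> nat \<Rightarrow> real"
  assumes "\<And>k i. i < n \<Longrightarrow> \<bar>u k i\<bar> \<le> B"
  obtains r where "strict_mono (r :: nat \<Rightarrow> nat)" "\<And>i. i < n \<Longrightarrow> convergent (\<lambda>k. u (r k) i)"
proof -
  have "\<exists>r. strict_mono (r :: nat \<Rightarrow> nat) \<and> (\<forall>i<n. convergent (\<lambda>k. u (r k) i))"
    using assms
  proof (induction n)
    case 0
    then show ?case by (intro exI[of _ id]) (auto simp: strict_mono_def)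
  next
    case (Suc n)
    then obtain r :: "nat \<Rightarrow> nat" where r: "strict_mono r" "\<forall>i<n. convergent (\<lambda>k. u (r k) i)"
      by (metis less_SucI)
    have "bounded (range (\<lambda>k. u (r k) n))"
      unfolding bounded_iff using Suc.prems[of n] by (intro exI[of _ B]) auto
    then obtain l s where s: "strict_mono (s :: nat \<Rightarrow> nat)" "((\<lambda>k. u (r k) n) \<circ> s) \<longlonglongrightarrow> l"
      using bounded_imp_convergent_subsequence by blast
    have "convergent (\<lambda>k. u ((r \<circ> s) k) i)" if "i < Suc n" for i
    proof (cases "i = n")
      case True
      then show ?thesis using s(2) by (auto simp: convergent_def o_def)
    next
      case False
      then have "convergent (\<lambda>k. u (r k) i)" using r that by simp
      from convergent_subseq_convergent[OF this s(1)] show ?thesis by (simp add: o_def)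
    qed
    then show ?case using strict_mono_o[OF r(1) s(1)] by blast
  qed
  then show ?thesis using that by blast
qed

lemma log_concave_liminf:
  assumes u: "\<And>k. log_concave (u k)"
    and g: "\<And>x. ennreal (g x) = liminf (\<lambda>k. ennreal (u k x))" and nn: "\<And>x. 0 \<le> g x"
  shows "log_concave g"
  unfolding log_concave_def
proof (intro allI impI)
  fix x y and l :: real assume a: "0 \<le> l" "l \<le> 1" "0 < g x" "0 < g y"
  show "g x powr (1 - l) * g y powr l \<le> g (geod x y l)"
  proof (rule field_le_mult_one_interval)
    fix \<theta> :: real assume \<theta>: "0 < \<theta>" "\<theta> < 1"
    have ev: "\<forall>\<^sub>F k in sequentially. \<theta> * g z < u k z" if "0 < g z" for z
    proof -
      have "ennreal (\<theta> * g z) < liminf (\<lambda>k. ennreal (u k z))"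
        using \<theta> that by (simp flip: g add: ennreal_less_iff)
      from less_LiminfD[OF this] show ?thesis
        by eventually_elim (use \<theta> that in \<open>simp add: ennreal_less_iff\<close>)
    qed
    have "\<forall>\<^sub>F k in sequentially. ennreal (\<theta> * (g x powr (1 - l) * g y powr l)) \<le> ennreal (u k (geod x y l))"
      using ev[OF a(3)] ev[OF a(4)]
    proof eventually_elim
      case (elim k)
      have pos: "0 < u k x" "0 < u k y" using elim \<theta> a by (meson less_trans mult_pos_pos)+
      have "\<theta> * (g x powr (1 - l) * g y powr l) = \<theta> powr (1 - l + l) * (g x powr (1 - l) * g y powr l)"
        using \<theta> by simp
      also have "\<dots> = (\<theta> * g x) powr (1 - l) * (\<theta> * g y) powr l"
        unfolding powr_add using \<theta> a by (simp add: powr_mult)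
      also have "\<dots> \<le> u k x powr (1 - l) * u k y powr l"
        using elim \<theta> a by (intro mult_mono powr_mono2) auto
      also have "\<dots> \<le> u k (geod x y l)" using log_concaveD[OF u a(1,2) pos] .
      finally show ?case by (rule ennreal_leI)
    qed
    then have "ennreal (\<theta> * (g x powr (1 - l) * g y powr l)) \<le> ennreal (g (geod x y l))"
      unfolding g by (rule Liminf_bounded)
    then show "\<theta> * (g x powr (1 - l) * g y powr l) \<le> g (geod x y l)"
      using nn by (simp add: ennreal_le_iff)
  qed
qed

locale sample =
  fixes n :: nat and xs :: "nat \<Rightarrow> t3"
  assumes two_points: "\<exists>i<n. \<exists>j<n. xs i \<noteq> xs j"
    and lik_positive: "\<exists>f\<in>F0. 0 < lik n f xs"
begin

definition mle :: "(t3 \<Rightarrow> real) \<Rightarrow> bool" where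
  "mle g \<longleftrightarrow> g \<in> F0 \<and> (\<forall>h\<in>F0. lik n h xs \<le> lik n g xs)"

lemma other_point: obtains j where "j < n" "xs j \<noteq> z"
  using two_points by metis

lemma subdensity_normalise:
  assumes nn: "\<And>x. 0 \<le> h x" and m: "h \<in> borel_measurable nu" and lc: "log_concave h"
    and le: "(\<integral>\<^sup>+ x. ennreal (h x) \<partial>nu) \<le> 1" and pos: "0 < lik n h xs"
  obtains g c where "g \<in> F0" "0 < c" "c \<le> 1" "(\<integral>\<^sup>+ x. ennreal (h x) \<partial>nu) = ennreal c"
    "lik n g xs = lik n h xs / c ^ n"
proof -
  obtain c where c: "0 \<le> c" "c \<le> 1" "(\<integral>\<^sup>+ x. ennreal (h x) \<partial>nu) = ennreal c"
    using le by (cases "\<integral>\<^sup>+ x. ennreal (h x) \<partial>nu" rule: ennreal_cases) (auto simp: top_unique)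
  obtain i j where ij: "i < n" "j < n" "xs i \<noteq> xs j" using two_points by blast
  have "0 < (\<integral>\<^sup>+ x. ennreal (h x) \<partial>nu)"
    using log_concave_integral_pos[OF lc _ _ ij(3)] lik_pos_imp[OF nn pos] ij by blast
  then have c0: "0 < c" using c by simp
  show ?thesis
  proof (rule that[of "\<lambda>x. h x / c" c])
    show "(\<lambda>x. h x / c) \<in> F0" using normalise_F0[OF nn m lc c(3) c0] .
    show "lik n (\<lambda>x. h x / c) xs = lik n h xs / c ^ n"
      by (simp add: lik_def prod_dividef)
  qed (use c c0 in auto)
qed

lemma mle_lik_pos: "mle g \<Longrightarrow> 0 < lik n g xs"
  using lik_positive unfolding mle_def by force

lemma mle_subdensity:
  assumes g: "mle g"
    and nn: "\<And>x. 0 \<le> h x" and m: "h \<in> borel_measurable nu" and lc: "log_concave h"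
    and le: "(\<integral>\<^sup>+ x. ennreal (h x) \<partial>nu) \<le> 1" and ge: "lik n g xs \<le> lik n h xs"
  shows "lik n h xs = lik n g xs" "(\<integral>\<^sup>+ x. ennreal (h x) \<partial>nu) = 1"
proof -
  have pos: "0 < lik n h xs" using mle_lik_pos[OF g] ge by linarith
  obtain k c where k: "k \<in> F0" "0 < c" "c \<le> 1" "(\<integral>\<^sup>+ x. ennreal (h x) \<partial>nu) = ennreal c"
    "lik n k xs = lik n h xs / c ^ n"
    using subdensity_normalise[OF nn m lc le pos] .
  have "lik n h xs / c ^ n \<le> lik n g xs" using g k unfolding mle_def by metis
  then have *: "lik n h xs \<le> lik n g xs * c ^ n" using k by (simp add: field_simps)
  have n: "0 < n" using two_points by auto
  have "c ^ n \<le> 1" using k by (simp add: power_le_one)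
  then have "lik n g xs * c ^ n \<le> lik n g xs" using mle_lik_pos[OF g] by (simp add: mult_left_le)
  then show eq: "lik n h xs = lik n g xs" using * ge by linarith
  then have "1 \<le> c ^ n" using * mle_lik_pos[OF g] by simp
  then have "c = 1" using k n by (metis less_eq_real_def power_less_one_iff not_less)
  then show "(\<integral>\<^sup>+ x. ennreal (h x) \<partial>nu) = 1" using k by simp
qed

lemma values_times_lik_bound:
  obtains B :: real where "0 < B" "\<And>g k. g \<in> F0 \<Longrightarrow> k < n \<Longrightarrow> g (xs k) * lik n g xs \<le> B"
proof -
  have "\<exists>C>0. xs k \<noteq> xs j \<longrightarrow> (\<forall>g\<in>F0. g (xs j) \<le> g (xs k) \<longrightarrow> g (xs k) ^ n * g (xs j) \<le> C)" for k j
  proof (cases "xs k = xs j")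
    case False
    then show ?thesis using F0_values_bound[OF False, of n] by metis
  qed (auto intro: exI[of _ 1])
  then obtain C where C: "\<And>k j. (0::real) < C k j"
    "\<And>k j g. xs k \<noteq> xs j \<Longrightarrow> g \<in> F0 \<Longrightarrow> g (xs j) \<le> g (xs k) \<Longrightarrow> g (xs k) ^ n * g (xs j) \<le> C k j"
    by metis
  have n: "0 < n" using two_points by auto
  define B where "B = (\<Sum>k<n. \<Sum>j<n. C k j)"
  have CB: "C k j \<le> B" if "k < n" "j < n" for k j
  proof -
    have "C k j \<le> (\<Sum>j<n. C k j)"
      using that C(1) by (intro member_le_sum) (auto intro: less_imp_le)
    also have "\<dots> \<le> B" unfolding B_def
      using that C(1) by (intro member_le_sum[of k "{..<n}" "\<lambda>k. \<Sum>j<n. C k j"])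
        (auto simp: less_imp_le intro!: sum_nonneg)
    finally show ?thesis .
  qed
  show ?thesis
  proof (rule that[of B])
    show "0 < B" using C(1)[of 0 0] CB[of 0 0] n by linarith
    fix g k assume g: "g \<in> F0" and k: "k < n"
    note nn = F0_nonneg[OF g]
    define M where "M = Max ((\<lambda>i. g (xs i)) ` {..<n})"
    have "M \<in> (\<lambda>i. g (xs i)) ` {..<n}" unfolding M_def using n by (intro Max_in) auto
    then obtain m where m: "m < n" "M = g (xs m)" by auto
    have le: "g (xs i) \<le> M" if "i < n" for i using that by (simp add: M_def)
    obtain j where j: "j < n" "xs j \<noteq> xs m" by (rule other_point)
    have "lik n g xs = g (xs j) * (\<Prod>i\<in>{..<n} - {j}. g (xs i))"
      unfolding lik_def using j by (intro prod.remove) auto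
    also have "\<dots> \<le> g (xs j) * (\<Prod>i\<in>{..<n} - {j}. M)"
      using nn le by (intro mult_left_mono prod_mono) auto
    also have "\<dots> = g (xs j) * M ^ (n - 1)" using j by simp
    finally have "g (xs k) * lik n g xs \<le> M * (g (xs j) * M ^ (n - 1))"
      using le[OF k] nn[of "xs k"] by (intro mult_mono lik_nonneg nn) (auto simp: m nn)
    also have "\<dots> = M ^ n * g (xs j)" using n by (cases n) auto
    also have "\<dots> \<le> C m j" using C(2)[of m j g] j g le[OF j(1)] m by auto
    also have "\<dots> \<le> B" using CB m j by simp
    finally show "g (xs k) * lik n g xs \<le> B" .
  qed
qed

lemma mle_exists: "\<exists>g. mle g"
proof -
  obtain B where B: "0 < B" "\<And>g k. g \<in> F0 \<Longrightarrow> k < n \<Longrightarrow> g (xs k) * lik n g xs \<le> B"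
    using values_times_lik_bound by metis
  have bdd: "lik n g xs \<le> max 1 B" if g: "g \<in> F0" for g
  proof (cases "\<forall>k<n. g (xs k) \<le> 1")
    case True
    then have "lik n g xs \<le> 1" unfolding lik_def using F0_nonneg[OF g] by (intro prod_le_1) auto
    then show ?thesis by simp
  next
    case False
    then obtain k where k: "k < n" "1 \<le> g (xs k)" by force
    have "1 * lik n g xs \<le> g (xs k) * lik n g xs"
      using k lik_nonneg[OF F0_nonneg[OF g]] by (intro mult_right_mono) auto
    then show ?thesis using B(2)[OF g k(1)] by simp
  qed
  define L where "L = (SUP g\<in>F0. lik n g xs)"
  have bddA: "bdd_above ((\<lambda>g. lik n g xs) ` F0)" using bdd by (intro bdd_aboveI2)
  have upper: "lik n g xs \<le> L" if "g \<in> F0" for g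
    unfolding L_def using that bddA by (intro cSUP_upper)
  have L0: "0 < L" using lik_positive upper by force
  have "\<exists>h\<in>F0. L * (1 - 1 / (real k + 2)) < lik n h xs" for k
  proof -
    have "L * (1 - 1 / (real k + 2)) < L" using L0 by (simp add: field_simps)
    then show ?thesis
      using less_cSUP_iff[OF _ bddA] lik_positive unfolding L_def by blast
  qed
  then obtain h where h: "\<And>k. h k \<in> F0" "\<And>k. L * (1 - 1 / (real k + 2)) < lik n (h k) xs"
    by metis
  have half: "L / 2 < lik n (h k) xs" for k
  proof -
    have "L * (1 / 2) \<le> L * (1 - 1 / (real k + 2))"
      using L0 by (intro mult_left_mono) (auto simp: field_simps)
    then show ?thesis using h(2)[of k] by linarith
  qed
  have lim: "(\<lambda>k. lik n (h k) xs) \<longlonglongrightarrow> L"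
  proof (rule tendsto_sandwich)
    show "(\<lambda>k. L * (1 - 1 / (real k + 2))) \<longlonglongrightarrow> L"
      by real_asymp
  qed (use h upper in \<open>auto simp: less_imp_le\<close>)
  define D where "D = B / (L / 2)"
  have D: "h k (xs i) \<le> D" if "i < n" for k i
  proof -
    have "h k (xs i) * (L / 2) \<le> h k (xs i) * lik n (h k) xs"
      using half F0_nonneg[OF h(1)] by (intro mult_left_mono) (auto intro: less_imp_le)
    also have "\<dots> \<le> B" using B(2) h that by simp
    finally show ?thesis unfolding D_def using L0 by (simp add: field_simps)
  qed
  have "\<bar>h k (xs i)\<bar> \<le> D" if "i < n" for k i using D[OF that, of k] F0_nonneg[OF h(1)] by simp
  from bounded_family_subseq[of n "\<lambda>k i. h k (xs i)" D, OF this]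
  obtain r where r: "strict_mono (r :: nat \<Rightarrow> nat)" "\<And>i. i < n \<Longrightarrow> convergent (\<lambda>k. h (r k) (xs i))"
    by blast
  define u where "u k = h (r k)" for k
  have uF: "u k \<in> F0" for k using h by (simp add: u_def)
  obtain v where v: "\<And>i. i < n \<Longrightarrow> (\<lambda>k. u k (xs i)) \<longlonglongrightarrow> v i"
    using r(2) unfolding convergent_def u_def by metis
  have "(\<lambda>k. lik n (u k) xs) \<longlonglongrightarrow> (\<Prod>i<n. v i)"
    unfolding lik_def using v by (intro tendsto_prod) auto
  moreover have "(\<lambda>k. lik n (u k) xs) \<longlonglongrightarrow> L"
    unfolding u_def using LIMSEQ_subseq_LIMSEQ[OF lim r(1)] by (simp add: o_def)
  ultimately have vL: "(\<Prod>i<n. v i) = L" by (rule LIMSEQ_unique)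
  have v0: "0 \<le> v i" if "i < n" for i
    using v[OF that] F0_nonneg[OF uF] by (intro LIMSEQ_le_const) auto
  have vpos: "0 < v i" if "i < n" for i
  proof (rule ccontr)
    assume "\<not> 0 < v i"
    then have "v i = 0" using v0[OF that] by simp
    then have "(\<Prod>i<n. v i) = 0" using that by (intro prod_zero) auto
    then show False using vL L0 by simp
  qed
  define G where "G z = liminf (\<lambda>k. ennreal (u k z))" for z
  have fin: "G z < \<infinity>" for z
  proof -
    obtain j where j: "j < n" "xs j \<noteq> z" by (rule other_point)
    obtain C :: real where C: "0 < C" "\<And>g. g \<in> F0 \<Longrightarrow> g (xs j) \<le> g z \<Longrightarrow> g z ^ 1 * g (xs j) \<le> C"
      using F0_values_bound[of z "xs j" 1] j by metis
    have "\<forall>\<^sub>F k in sequentially. v j / 2 < u k (xs j)"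
      using order_tendstoD(1)[OF v[OF j(1)], of "v j / 2"] vpos[OF j(1)] by simp
    then have "\<forall>\<^sub>F k in sequentially. ennreal (u k z) \<le> ennreal (max D (C / (v j / 2)))"
    proof eventually_elim
      case (elim k)
      have "u k z \<le> max D (C / (v j / 2))"
      proof (cases "u k (xs j) \<le> u k z")
        case True
        have "u k z * (v j / 2) \<le> u k z * u k (xs j)"
          using elim F0_nonneg[OF uF] by (intro mult_left_mono) auto
        also have "\<dots> \<le> C" using C(2)[OF uF True] by simp
        finally have "u k z \<le> C / (v j / 2)" using vpos[OF j(1)] by (simp add: field_simps)
        then show ?thesis by simp
      next
        case False
        then show ?thesis using D[OF j(1), of "r k"] by (simp add: u_def)
      qed
      then show ?case by (rule ennreal_leI)
    qed
    then have "G z \<le> ennreal (max D (C / (v j / 2)))"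
      unfolding G_def by (intro Liminf_le) auto
    then show ?thesis by (metis ennreal_less_top infinity_ennreal_def order.strict_trans1)
  qed
  define g where "g z = enn2real (G z)" for z
  have gG: "ennreal (g z) = G z" for z using fin[of z] by (simp add: g_def)
  have nn: "0 \<le> g z" for z by (simp add: g_def)
  have [measurable]: "u k \<in> borel_measurable nu" for k using F0_measurable[OF uF] .
  have "G \<in> borel_measurable nu" unfolding G_def by measurable
  then have m: "g \<in> borel_measurable nu" unfolding g_def by measurable
  have lc: "log_concave g"
    by (rule log_concave_liminf[of u]) (use gG nn F0_log_concave[OF uF] in \<open>auto simp: G_def\<close>)
  have "(\<integral>\<^sup>+ x. ennreal (g x) \<partial>nu) \<le> liminf (\<lambda>k. \<integral>\<^sup>+ x. ennreal (u k x) \<partial>nu)"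
    unfolding gG G_def by (rule nn_integral_liminf) measurable
  also have "\<dots> = 1" by (simp add: F0_integral[OF uF] Liminf_const)
  finally have le: "(\<integral>\<^sup>+ x. ennreal (g x) \<partial>nu) \<le> 1" .
  have gv: "g (xs i) = v i" if "i < n" for i
  proof -
    have "(\<lambda>k. ennreal (u k (xs i))) \<longlonglongrightarrow> ennreal (v i)" using v[OF that] by (rule tendsto_ennrealI)
    then have "G (xs i) = ennreal (v i)" unfolding G_def by (intro lim_imp_Liminf) auto
    then show ?thesis using v0[OF that] by (simp add: g_def)
  qed
  then have gL: "lik n g xs = L" unfolding lik_def vL[symmetric] by (intro prod.cong) auto
  then have "0 < lik n g xs" using L0 by simp
  from subdensity_normalise[OF nn m lc le this]
  obtain k c where k: "k \<in> F0" "0 < c" "c \<le> 1" "lik n k xs = lik n g xs / c ^ n" by metis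
  have "c ^ n \<le> 1" using k by (simp add: power_le_one)
  then have "L * c ^ n \<le> L" using L0 by (simp add: mult_left_le)
  then have "L \<le> lik n k xs" using k gL by (simp add: pos_le_divide_eq)
  then show ?thesis using k(1) upper unfolding mle_def by (meson order_trans)
qed

end

subsection \<open>Uniqueness of the maximizer\<close>

lemma geod_commute: "0 \<le> l \<Longrightarrow> l \<le> 1 \<Longrightarrow> geod x y l = geod y x (1 - l)"
proof -
  assume l: "0 \<le> l" "l \<le> 1"
  obtain i j a b where "i < 3" "j < 3" "i \<noteq> j" "x = line_pt i j a" "y = line_pt i j b"
    by (rule common_line)
  then show ?thesis using l by (auto simp: geod_line_pt algebra_simps)
qed

lemma geod_geod:
  assumes "0 \<le> s" "s \<le> 1" "0 \<le> u" "u \<le> 1"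
  shows "geod p (geod p q s) u = geod p q (s * u)"
proof -
  obtain i j a b where "i < 3" "j < 3" "i \<noteq> j" "p = line_pt i j a" "q = line_pt i j b"
    by (rule common_line)
  moreover have "(1 - u) * a + u * ((1 - s) * a + s * b) = (1 - s * u) * a + s * u * b"
    by (simp add: algebra_simps)
  ultimately show ?thesis using assms by (simp add: geod_line_pt mult_le_one)
qed

lemma common_line_less:
  assumes "p \<noteq> q"
  obtains i j a b where "i < 3" "j < 3" "i \<noteq> j" "p = line_pt i j a" "q = line_pt i j b" "a < b"
proof -
  obtain i j a b where ij: "i < 3" "j < 3" "i \<noteq> j" "p = line_pt i j a" "q = line_pt i j b"
    by (rule common_line)
  have swap: "line_pt i j c = line_pt j i (- c)" for c
    by (auto simp: line_pt_def pt_nonpos)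
  show ?thesis
  proof (cases "a < b")
    case False
    then have "- a < - b" using ij assms by (cases "a = b") auto
    then show ?thesis using that[of j i "-a" "-b"] ij swap by metis
  qed (use that ij in blast)
qed

lemma log_concave_AE_eq_line:
  assumes lc: "log_concave g1" "log_concave g2" and ae: "AE x in nu. g1 x = g2 x"
    and ij: "i < 3" "j < 3" "i \<noteq> j"
    and pos1: "0 < g1 (line_pt i j a)" "0 < g1 (line_pt i j b)"
    and pos2: "0 < g2 (line_pt i j a)" "0 < g2 (line_pt i j b)"
    and t: "a < t" "t < b"
  shows "g1 (line_pt i j t) = g2 (line_pt i j t)"
proof (rule ccontr)
  assume ne: "g1 (line_pt i j t) \<noteq> g2 (line_pt i j t)"
  have cont: "continuous_on {a<..<b} (\<lambda>s. - ln (g (line_pt i j s)))"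
    if g: "log_concave g" and pos: "0 < g (line_pt i j a)" "0 < g (line_pt i j b)" for g
  proof (rule convex_on_continuous)
    have p: "0 < g (line_pt i j s)" if "a < s" "s < b" for s
      using log_concave_pos_line[OF g ij pos] that by simp
    show "convex_on {a<..<b} (\<lambda>s. - ln (g (line_pt i j s)))"
    proof (rule convex_onI)
      fix l x y :: real
      assume l: "0 < l" "l < 1" and xy: "x \<in> {a<..<b}" "y \<in> {a<..<b}"
      let ?w = "(1 - l) * x + l * y"
      have px: "0 < g (line_pt i j x)" "0 < g (line_pt i j y)" using xy p by auto
      have "g (line_pt i j x) powr (1 - l) * g (line_pt i j y) powr l \<le> g (line_pt i j ?w)"
        using log_concaveD[OF g _ _ px, of l] l ij by (simp add: geod_line_pt)
      then have "ln (g (line_pt i j x) powr (1 - l) * g (line_pt i j y) powr l) \<le> ln (g (line_pt i j ?w))"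
        using px by (intro ln_mono) auto
      then have "(1 - l) * ln (g (line_pt i j x)) + l * ln (g (line_pt i j y)) \<le> ln (g (line_pt i j ?w))"
        using px by (simp add: ln_mult ln_powr)
      then show "- ln (g (line_pt i j ((1 - l) *\<^sub>R x + l *\<^sub>R y)))
          \<le> (1 - l) * - ln (g (line_pt i j x)) + l * - ln (g (line_pt i j y))"
        by (simp add: algebra_simps)
    qed simp
  qed simp
  let ?d = "\<lambda>s. - ln (g1 (line_pt i j s)) - - ln (g2 (line_pt i j s))"
  have "continuous_on {a<..<b} ?d"
    by (intro continuous_on_diff cont lc pos1 pos2)
  then have op: "open ({a<..<b} \<inter> ?d -` (- {0}))"
    by (intro continuous_open_preimage) auto
  have pt: "0 < g1 (line_pt i j t)" "0 < g2 (line_pt i j t)"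
    using log_concave_pos_line[OF lc(1) ij pos1] log_concave_pos_line[OF lc(2) ij pos2] t by auto
  then have "t \<in> {a<..<b} \<inter> ?d -` (- {0})" using ne t by simp
  then obtain e where e: "0 < e" "ball t e \<subseteq> {a<..<b} \<inter> ?d -` (- {0})"
    using op open_contains_ball by blast
  obtain s where s: "t < s" "s < t + e" "g1 (line_pt i j s) = g2 (line_pt i j s)"
    using AE_dense_line[OF ae, of t "t + e" i j] e ij by auto
  then have "s \<in> ball t e" by (simp add: dist_real_def)
  then have "?d s \<noteq> 0" using e by blast
  then show False using s by simp
qed

lemma log_concave_AE_eq_geod:
  assumes lc: "log_concave g1" "log_concave g2" and ae: "AE x in nu. g1 x = g2 x"
    and pos: "0 < g1 p" "0 < g2 p" "0 < g1 q" and "p \<noteq> q" and l: "0 < l" "l < 1"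
  shows "g1 (geod p q l) = g2 (geod p q l)"
proof -
  obtain i j a b where ij: "i < 3" "j < 3" "i \<noteq> j"
    and pq: "p = line_pt i j a" "q = line_pt i j b" and ab: "a < b"
    by (rule common_line_less[OF \<open>p \<noteq> q\<close>])
  define t where "t = (1 - l) * a + l * b"
  have "t = a + l * (b - a)" "t = b - (1 - l) * (b - a)" by (auto simp: t_def algebra_simps)
  moreover have "0 < l * (b - a)" "0 < (1 - l) * (b - a)" using ab l by auto
  ultimately have t: "a < t" "t < b" by linarith+
  obtain s where s: "t < s" "s < b" "g1 (line_pt i j s) = g2 (line_pt i j s)"
    using AE_dense_line[OF ae t(2) ij(1,2)] by blast
  have ps: "0 < g1 (line_pt i j s)"
    using log_concave_pos_line[OF lc(1) ij, of a b s] pos pq s t by simp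
  have "g1 (line_pt i j t) = g2 (line_pt i j t)"
    by (rule log_concave_AE_eq_line[OF lc ae ij, of a s]) (use pos pq s ps t in auto)
  then show ?thesis using pq ij l by (simp add: geod_line_pt t_def)
qed

lemma log_concave_raise_value:
  assumes nn: "\<And>x. 0 \<le> g1 x"
    and lc: "log_concave g1" "log_concave g2" and ae: "AE x in nu. g1 x = g2 x"
    and pos: "0 < g1 p" and less: "g1 p < g2 p"
  shows "log_concave (g1(p := g2 p))" (is "log_concave ?h")
proof -
  have pos2: "0 < g2 p" using pos less by linarith
  have ge: "g1 x \<le> ?h x" for x using less by simp
  have key: "g2 p powr (1 - l) * g1 y powr l \<le> g1 (geod p y l)"
    if y: "0 < g1 y" "p \<noteq> y" and l: "0 < l" "l < 1" for y l
  proof -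
    have bound: "g2 p powr (1 - l / s) * (g1 p powr (1 - s) * g1 y powr s) powr (l / s) \<le> g1 (geod p y l)"
      if s: "l < s" "s < 1" for s
    proof -
      have s0: "0 < s" "0 < l / s" "l / s < 1" using s l by auto
      have eq: "g1 (geod p y s) = g2 (geod p y s)"
        by (rule log_concave_AE_eq_geod[OF lc ae pos pos2 y]) (use s s0 in auto)
      have p1: "0 < g1 (geod p y s)" using log_concave_pos[OF lc(1) _ _ pos y(1)] s s0 by simp
      have "g1 p powr (1 - s) * g1 y powr s \<le> g2 (geod p y s)"
        using log_concaveD[OF lc(1) _ _ pos y(1), of s] s s0 eq by simp
      then have "g2 p powr (1 - l / s) * (g1 p powr (1 - s) * g1 y powr s) powr (l / s)
          \<le> g2 p powr (1 - l / s) * g2 (geod p y s) powr (l / s)"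
        using s0 by (intro mult_left_mono powr_mono2) auto
      also have "\<dots> \<le> g2 (geod p (geod p y s) (l / s))"
        using log_concaveD[OF lc(2) _ _ pos2, of "l / s" "geod p y s"] p1 eq s0 by simp
      also have "geod p (geod p y s) (l / s) = geod p y l"
        using s s0 by (subst geod_geod) auto
      also have "g2 (geod p y l) = g1 (geod p y l)"
        using log_concave_AE_eq_geod[OF lc ae pos pos2 y l] by simp
      finally show ?thesis .
    qed
    have "((\<lambda>s. g2 p powr (1 - l / s) * (g1 p powr (1 - s) * g1 y powr s) powr (l / s)) \<longlongrightarrow>
        g2 p powr (1 - l / 1) * (g1 p powr (1 - 1) * g1 y powr 1) powr (l / 1)) (at_left 1)"
      using pos pos2 y by (intro tendsto_intros) auto
    moreover have "\<forall>\<^sub>F s in at_left 1. g2 p powr (1 - l / s) * (g1 p powr (1 - s) * g1 y powr s) powr (l / s)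
        \<le> g1 (geod p y l)"
      using eventually_at_left_real[OF l(2)] by eventually_elim (use bound in auto)
    ultimately have "g2 p powr (1 - l / 1) * (g1 p powr (1 - 1) * g1 y powr 1) powr (l / 1) \<le> g1 (geod p y l)"
      by (rule tendsto_upperbound) simp
    then show ?thesis using pos y by simp
  qed
  show ?thesis
  proof (rule log_concaveI)
    show "0 \<le> ?h x" for x using nn pos2 by simp
    fix x y and l :: real
    assume a: "0 < l" "l < 1" "0 < ?h x" "0 < ?h y" "x \<noteq> y"
    have "?h x powr (1 - l) * ?h y powr l \<le> g1 (geod x y l)"
    proof -
      consider "x = p" | "y = p" "x \<noteq> p" | "x \<noteq> p" "y \<noteq> p" by blast
      then show ?thesis
      proof cases
        case 1
        then show ?thesis using key[of y l] a by simp
      next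
        case 2
        then show ?thesis using key[of x "1 - l"] a geod_commute[of l x y] by (simp add: mult.commute)
      next
        case 3
        then show ?thesis using log_concaveD[OF lc(1), of l x y] a by simp
      qed
    qed
    also have "\<dots> \<le> ?h (geod x y l)" by (rule ge)
    finally show "?h x powr (1 - l) * ?h y powr l \<le> ?h (geod x y l)" .
  qed
qed

lemma log_concave_geometric_mean:
  assumes lc: "log_concave g1" "log_concave g2" and nn: "\<And>x. 0 \<le> g1 x" "\<And>x. 0 \<le> g2 x"
  shows "log_concave (\<lambda>x. sqrt (g1 x * g2 x))"
proof (rule log_concaveI)
  fix x y and l :: real
  assume a: "0 < l" "l < 1" "0 < sqrt (g1 x * g2 x)" "0 < sqrt (g1 y * g2 y)"
  have pos: "0 < g1 x" "0 < g2 x" "0 < g1 y" "0 < g2 y"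
    using a nn[of x] nn[of y] by (auto simp: zero_less_mult_iff less_le)
  have "sqrt (g1 x * g2 x) powr (1 - l) * sqrt (g1 y * g2 y) powr l
      = sqrt ((g1 x powr (1 - l) * g1 y powr l) * (g2 x powr (1 - l) * g2 y powr l))"
    using pos by (simp add: powr_half_sqrt[symmetric] powr_mult powr_powr mult_ac)
  also have "\<dots> \<le> sqrt (g1 (geod x y l) * g2 (geod x y l))"
    using log_concaveD[OF lc(1), of l x y] log_concaveD[OF lc(2), of l x y] a pos nn
    by (intro real_sqrt_le_mono mult_mono) auto
  finally show "sqrt (g1 x * g2 x) powr (1 - l) * sqrt (g1 y * g2 y) powr l
      \<le> sqrt (g1 (geod x y l) * g2 (geod x y l))" .
qed (use nn in simp)

definition geod_convex :: "t3 set \<Rightarrow> bool" where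
  "geod_convex K \<longleftrightarrow> (\<forall>x\<in>K. \<forall>y\<in>K. \<forall>l. 0 \<le> l \<longrightarrow> l \<le> 1 \<longrightarrow> geod x y l \<in> K)"

lemma geod_convex_outer:
  assumes "0 < s"
  shows "geod_convex {x. branch x = k \<and> s \<le> rad x}"
  unfolding geod_convex_def
proof (intro ballI allI impI)
  fix x y and l :: real
  assume x: "x \<in> {x. branch x = k \<and> s \<le> rad x}" and y: "y \<in> {x. branch x = k \<and> s \<le> rad x}"
    and l: "0 \<le> l" "l \<le> 1"
  have "(1 - l) * (- rad x) + l * (- rad y) \<le> - s"
    using x y l by (intro convex_bound_le) auto
  then have "s \<le> (1 - l) * rad x + l * rad y" by simp
  then show "geod x y l \<in> {x. branch x = k \<and> s \<le> rad x}"
    using x y assms branch_less[of x] by (simp add: geod_def branch_pt rad_pt)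
qed

lemma geod_convex_inner:
  assumes "0 \<le> s"
  shows "geod_convex {x. \<not> (branch x = k \<and> s < rad x)}"
  unfolding geod_convex_def
proof (intro ballI allI impI)
  fix x y and l :: real
  assume x: "x \<in> {x. \<not> (branch x = k \<and> s < rad x)}" and y: "y \<in> {x. \<not> (branch x = k \<and> s < rad x)}"
    and l: "0 \<le> l" "l \<le> 1"
  have mem: "pt i r \<in> {x. \<not> (branch x = k \<and> s < rad x)}" if "i < 3" "i = k \<Longrightarrow> r \<le> s" for i r
    using that assms by (cases "0 < r") (auto simp: branch_pt rad_pt pt_nonpos)
  show "geod x y l \<in> {x. \<not> (branch x = k \<and> s < rad x)}"
  proof (cases "branch x = branch y")
    case True
    then have "geod x y l = pt (branch x) ((1 - l) * rad x + l * rad y)" by (simp add: geod_def)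
    moreover have "(1 - l) * rad x + l * rad y \<le> s" if "branch x = k"
      using x y l True that by (intro convex_bound_le) auto
    ultimately show ?thesis using mem by simp
  next
    case False
    have "l * (rad x + rad y) \<le> rad x + rad y" using l by (simp add: mult_left_le_one_le)
    moreover have "0 \<le> l * (rad x + rad y)" using l by simp
    ultimately show ?thesis
      using mem[of "branch x" "rad x - l * (rad x + rad y)"]
        mem[of "branch y" "l * (rad x + rad y) - rad x"] x y False
      by (simp add: geod_def Let_def) linarith
  qed
qed

context sample
begin

lemma mle_lik_eq: "mle g1 \<Longrightarrow> mle g2 \<Longrightarrow> lik n g1 xs = lik n g2 xs"
  by (auto simp: mle_def intro!: order_antisym)

lemma mle_pos_sample: "mle g \<Longrightarrow> i < n \<Longrightarrow> 0 < g (xs i)"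
  using lik_pos_imp[of g n xs i] mle_lik_pos[of g] F0_nonneg[of g] by (simp add: mle_def)

lemma mle_AE_unique:
  assumes g1: "mle g1" and g2: "mle g2"
  shows "AE x in nu. g1 x = g2 x"
proof -
  have F: "g1 \<in> F0" "g2 \<in> F0" using assms by (auto simp: mle_def)
  note nn = F0_nonneg[OF F(1)] F0_nonneg[OF F(2)]
  note [measurable] = F0_measurable[OF F(1)] F0_measurable[OF F(2)]
  let ?h = "\<lambda>x. sqrt (g1 x * g2 x)"
  let ?e = "\<lambda>x. (sqrt (g1 x) - sqrt (g2 x))\<^sup>2"
  have "(\<integral>\<^sup>+ x. ennreal (?e x) \<partial>nu) + 2 * (\<integral>\<^sup>+ x. ennreal (?h x) \<partial>nu)
      = (\<integral>\<^sup>+ x. ennreal (?e x) + 2 * ennreal (?h x) \<partial>nu)"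
    by (simp add: nn_integral_add nn_integral_cmult)
  also have "\<dots> = (\<integral>\<^sup>+ x. ennreal (g1 x) + ennreal (g2 x) \<partial>nu)"
  proof (rule nn_integral_cong)
    fix x
    have "?e x + 2 * ?h x = g1 x + g2 x"
      using nn[of x] by (simp add: power2_diff real_sqrt_mult)
    moreover have "ennreal (?e x) + 2 * ennreal (?h x) = ennreal (?e x + 2 * ?h x)"
      using nn by (simp add: ennreal_mult)
    ultimately show "ennreal (?e x) + 2 * ennreal (?h x) = ennreal (g1 x) + ennreal (g2 x)"
      using nn by simp
  qed
  also have "\<dots> = 2 * 1" by (simp add: nn_integral_add F0_integral F)
  finally have sum: "(\<integral>\<^sup>+ x. ennreal (?e x) \<partial>nu) + 2 * (\<integral>\<^sup>+ x. ennreal (?h x) \<partial>nu) = 2 * 1" .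
  then have "2 * (\<integral>\<^sup>+ x. ennreal (?h x) \<partial>nu) \<le> 2 * 1"
    by (metis add.commute le_iff_add)
  then have le: "(\<integral>\<^sup>+ x. ennreal (?h x) \<partial>nu) \<le> 1"
    by (subst (asm) ennreal_mult_le_mult_iff) auto
  have "(lik n ?h xs)\<^sup>2 = lik n g1 xs * lik n g2 xs"
    unfolding lik_def using nn by (simp add: prod_power_distrib flip: prod.distrib)
  also have "\<dots> = (lik n g1 xs)\<^sup>2" using mle_lik_eq[OF g1 g2] by (simp add: power2_eq_square)
  finally have eq: "lik n ?h xs = lik n g1 xs"
    by (rule power2_eq_imp_eq) (use nn in \<open>auto intro!: lik_nonneg\<close>)
  have "(\<integral>\<^sup>+ x. ennreal (?h x) \<partial>nu) = 1"
    by (rule mle_subdensity(2)[OF g1])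
      (use nn le eq log_concave_geometric_mean[OF F0_log_concave[OF F(1)] F0_log_concave[OF F(2)] nn]
        in auto)
  then have "(\<integral>\<^sup>+ x. ennreal (?e x) \<partial>nu) + 2 = 0 + 2" using sum by (simp only: mult_1_right add_0)
  then have "(\<integral>\<^sup>+ x. ennreal (?e x) \<partial>nu) = 0"
    unfolding add.commute[of _ 2] ennreal_add_left_cancel by auto
  then have "AE x in nu. ennreal (?e x) = 0" by (subst (asm) nn_integral_0_iff_AE) auto
  then show ?thesis by eventually_elim simp
qed

lemma mle_unique_on_sample:
  assumes g1: "mle g1" and g2: "mle g2" and i: "i < n"
  shows "g1 (xs i) = g2 (xs i)"
proof -
  have "\<not> g1 (xs i) < g2 (xs i)" if g1: "mle g1" and g2: "mle g2" for g1 g2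
  proof
    assume less: "g1 (xs i) < g2 (xs i)"
    let ?p = "xs i"
    let ?h = "g1(?p := g2 ?p)"
    have F: "g1 \<in> F0" "g2 \<in> F0" using that by (auto simp: mle_def)
    have [measurable]: "g1 \<in> borel_measurable nu" using F0_measurable F by blast
    have [measurable]: "{?p} \<in> sets nu" using singleton_null[of ?p] by auto
    have nn: "0 \<le> ?h x" for x using F0_nonneg[OF F(1)] F0_nonneg[OF F(2)] by simp
    have ge: "g1 x \<le> ?h x" for x using less by simp
    have "?h = (\<lambda>x. if x \<in> {?p} then g2 ?p else g1 x)" by auto
    also have "\<dots> \<in> borel_measurable nu" by measurable
    finally have m: "?h \<in> borel_measurable nu" .
    have lc: "log_concave ?h"
      by (rule log_concave_raise_value)
        (use F0_nonneg[OF F(1)] F0_log_concave F mle_AE_unique[OF that] mle_pos_sample[OF g1 i] less in auto)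
    have "AE x in nu. x \<notin> {?p}" using singleton_null by (rule AE_not_in)
    then have "AE x in nu. ennreal (?h x) = ennreal (g1 x)" by eventually_elim simp
    then have "(\<integral>\<^sup>+ x. ennreal (?h x) \<partial>nu) = (\<integral>\<^sup>+ x. ennreal (g1 x) \<partial>nu)"
      by (rule nn_integral_cong_AE)
    then have int: "(\<integral>\<^sup>+ x. ennreal (?h x) \<partial>nu) \<le> 1" using F0_integral[OF F(1)] by simp
    have "lik n g1 xs = g1 ?p * (\<Prod>k\<in>{..<n} - {i}. g1 (xs k))"
      unfolding lik_def using i by (intro prod.remove) auto
    also have "\<dots> < g2 ?p * (\<Prod>k\<in>{..<n} - {i}. g1 (xs k))"
      using mle_pos_sample[OF g1] less by (intro mult_strict_right_mono prod_pos) auto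
    also have "\<dots> \<le> g2 ?p * (\<Prod>k\<in>{..<n} - {i}. ?h (xs k))"
      using ge F0_nonneg[OF F(1)] F0_nonneg[OF F(2)] by (intro mult_left_mono prod_mono) auto
    also have "\<dots> = (\<Prod>k<n. ?h (xs k))"
      using i by (subst prod.remove[of "{..<n}" i]) auto
    finally have "lik n g1 xs < lik n ?h xs" by (simp only: lik_def)
    then show False using mle_subdensity(1)[OF g1 nn m lc int] by linarith
  qed
  from this[OF g1 g2] this[OF g2 g1] show ?thesis by linarith
qed

lemma mle_support:
  assumes g: "mle g" and K: "geod_convex K" "K \<in> sets nu" and xs: "\<And>i. i < n \<Longrightarrow> xs i \<in> K"
  shows "AE x in nu. x \<notin> K \<longrightarrow> g x = 0"
proof -
  have F: "g \<in> F0" using g by (simp add: mle_def)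
  note nn = F0_nonneg[OF F]
  note [measurable] = F0_measurable[OF F] K(2)
  let ?h = "\<lambda>x. g x * indicator K x"
  let ?r = "\<lambda>x. g x * indicator (- K) x"
  have [measurable]: "- K \<in> sets nu" using K(2) sets.compl_sets[of K nu] by (simp add: Compl_eq_Diff_UNIV)
  have "(\<integral>\<^sup>+ x. ennreal (?h x) \<partial>nu) + (\<integral>\<^sup>+ x. ennreal (?r x) \<partial>nu)
      = (\<integral>\<^sup>+ x. ennreal (?h x) + ennreal (?r x) \<partial>nu)"
    by (simp add: nn_integral_add)
  also have "\<dots> = (\<integral>\<^sup>+ x. ennreal (g x) \<partial>nu)"
    by (rule nn_integral_cong) (auto simp: indicator_def)
  finally have sum: "(\<integral>\<^sup>+ x. ennreal (?h x) \<partial>nu) + (\<integral>\<^sup>+ x. ennreal (?r x) \<partial>nu) = 1"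
    using F0_integral[OF F] by simp
  then have le: "(\<integral>\<^sup>+ x. ennreal (?h x) \<partial>nu) \<le> 1" by (metis le_iff_add)
  have lc: "log_concave ?h"
    unfolding log_concave_def
  proof (intro allI impI)
    fix x y and l :: real
    assume a: "0 \<le> l" "l \<le> 1" "0 < ?h x" "0 < ?h y"
    have xy: "x \<in> K" "y \<in> K" using a by (cases "x \<in> K"; cases "y \<in> K"; simp)+
    then have "geod x y l \<in> K" using K a by (auto simp: geod_convex_def)
    then show "?h x powr (1 - l) * ?h y powr l \<le> ?h (geod x y l)"
      using log_concaveD[OF F0_log_concave[OF F] a(1,2), of x y] a xy by simp
  qed
  have "lik n ?h xs = lik n g xs"
    unfolding lik_def using xs by (intro prod.cong) auto
  then have "(\<integral>\<^sup>+ x. ennreal (?h x) \<partial>nu) = 1"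
    by (intro mle_subdensity(2)[OF g] lc le) (use nn in auto)
  then have "(\<integral>\<^sup>+ x. ennreal (?r x) \<partial>nu) + 1 = 0 + 1" using sum by (simp add: add.commute)
  then have "(\<integral>\<^sup>+ x. ennreal (?r x) \<partial>nu) = 0"
    unfolding add.commute[of _ 1] ennreal_add_left_cancel by auto
  then have "AE x in nu. ennreal (?r x) = 0" by (subst (asm) nn_integral_0_iff_AE) auto
  then show ?thesis by eventually_elim (use nn in \<open>auto simp: indicator_def ennreal_eq_0_iff dual_order.antisym\<close>)
qed

lemma mle_zero_below:
  assumes g: "mle g" and k: "k < 3" and z: "z = pt k r" "0 \<le> r"
    and xs: "\<And>i. i < n \<Longrightarrow> branch (xs i) = k \<and> r < rad (xs i)"
  shows "g z = 0"
proof (rule ccontr)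
  assume "g z \<noteq> 0"
  have F: "g \<in> F0" using g by (simp add: mle_def)
  have gz: "0 < g z" using \<open>g z \<noteq> 0\<close> F0_nonneg[OF F, of z] by linarith
  have n: "0 < n" using two_points by auto
  define s where "s = Min ((\<lambda>i. rad (xs i)) ` {..<n})"
  have "s \<in> (\<lambda>i. rad (xs i)) ` {..<n}" unfolding s_def using n by (intro Min_in) auto
  then obtain m where m: "m < n" "s = rad (xs m)" by auto
  have s: "r < s" "0 < s" using m xs[of m] z by auto
  let ?K = "{x. branch x = k \<and> s \<le> rad x}"
  have K: "?K \<in> sets nu" using sets_nu_rad_branch[of "\<lambda>r. s \<le> r" k] by simp
  have "xs i \<in> ?K" if "i < n" for i using that xs by (auto simp: s_def)
  then have ae: "AE x in nu. x \<notin> ?K \<longrightarrow> g x = 0"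
    by (intro mle_support[OF g] geod_convex_outer s K)
  obtain j where j: "j < 3" "j \<noteq> k" by (rule other_branch)
  obtain t where t: "r < t" "t < s" "line_pt k j t \<notin> ?K \<longrightarrow> g (line_pt k j t) = 0"
    using AE_dense_line[OF ae s(1) k j(1)] by blast
  have "line_pt k j t = pt k t" using t z by (simp add: line_pt_def)
  then have "g (line_pt k j t) = 0" using t z k by (auto simp: rad_pt)
  moreover have "0 < g (line_pt k j t)"
  proof (rule log_concave_pos_line[OF F0_log_concave[OF F] k j(1) j(2)[symmetric]])
    show "0 < g (line_pt k j r)" using gz z by (simp add: line_pt_def)
    have "line_pt k j s = xs m" using m s xs[of m] pt_branch_rad[of "xs m"] by (simp add: line_pt_def)
    then show "0 < g (line_pt k j s)" using mle_pos_sample[OF g m(1)] by simp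
  qed (use t in auto)
  ultimately show False by simp
qed

lemma mle_zero_beyond:
  assumes g: "mle g" and r: "0 < rad z"
    and xs: "\<And>i. i < n \<Longrightarrow> branch (xs i) = branch z \<Longrightarrow> rad (xs i) < rad z"
  shows "g z = 0"
proof (rule ccontr)
  assume "g z \<noteq> 0"
  have F: "g \<in> F0" using g by (simp add: mle_def)
  have gz: "0 < g z" using \<open>g z \<noteq> 0\<close> F0_nonneg[OF F, of z] by linarith
  have n: "0 < n" using two_points by auto
  let ?k = "branch z"
  let ?R = "insert 0 ((\<lambda>i. rad (xs i)) ` {i. i < n \<and> branch (xs i) = ?k})"
  define s where "s = Max ?R"
  have "s \<in> ?R" unfolding s_def by (intro Max_in) auto
  then have s: "s < rad z" using r xs by auto
  have s0: "0 \<le> s" unfolding s_def by (intro Max_ge) auto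
  have le: "rad (xs i) \<le> s" if "i < n" "branch (xs i) = ?k" for i
    unfolding s_def using that by (intro Max_ge) auto
  let ?K = "{x. \<not> (branch x = ?k \<and> s < rad x)}"
  have "{x. branch x = ?k \<and> s < rad x} \<in> sets nu" using sets_nu_rad_branch[of "\<lambda>r. s < r" ?k] by simp
  then have "space nu - {x. branch x = ?k \<and> s < rad x} \<in> sets nu" by blast
  moreover have "space nu - {x. branch x = ?k \<and> s < rad x} = ?K" by auto
  ultimately have K: "?K \<in> sets nu" by simp
  have "xs i \<in> ?K" if "i < n" for i using le[OF that] by auto
  then have ae: "AE x in nu. x \<notin> ?K \<longrightarrow> g x = 0"
    by (intro mle_support[OF g] geod_convex_inner s0 K)
  let ?p = "xs 0"
  have "\<exists>j a. j < 3 \<and> j \<noteq> ?k \<and> a \<le> s \<and> line_pt ?k j a = ?p"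
  proof (cases "branch ?p = ?k")
    case True
    obtain j where "j < 3" "j \<noteq> ?k" by (rule other_branch)
    then show ?thesis using le[OF n True] True pt_branch_rad[of ?p]
      by (intro exI[of _ j] exI[of _ "rad ?p"]) (auto simp: line_pt_def)
  next
    case False
    have "line_pt ?k (branch ?p) (- rad ?p) = ?p"
      using pt_branch_rad[of ?p] by (cases "rad ?p = 0") (auto simp: line_pt_def pt_nonpos less_le)
    then show ?thesis using False s0
      by (intro exI[of _ "branch ?p"] exI[of _ "- rad ?p"]) (auto intro: order_trans[of _ 0])
  qed
  then obtain j a where j: "j < 3" "j \<noteq> ?k" and a: "a \<le> s" "line_pt ?k j a = ?p" by blast
  obtain t where t: "s < t" "t < rad z" "line_pt ?k j t \<notin> ?K \<longrightarrow> g (line_pt ?k j t) = 0"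
    using AE_dense_line[OF ae s branch_less j(1)] by blast
  have "line_pt ?k j t = pt ?k t" using t s0 by (simp add: line_pt_def)
  then have "g (line_pt ?k j t) = 0" using t s0 by (auto simp: rad_pt branch_pt)
  moreover have "0 < g (line_pt ?k j t)"
  proof (rule log_concave_pos_line[OF F0_log_concave[OF F] branch_less j(1) j(2)[symmetric]])
    show "0 < g (line_pt ?k j a)" using a mle_pos_sample[OF g n] by simp
    show "0 < g (line_pt ?k j (rad z))" using gz by (simp add: line_pt_def pt_branch_rad)
  qed (use t a in auto)
  ultimately show False by simp
qed

lemma mle_pos_between:
  assumes g: "mle g" and gz: "0 < g z" and z: "\<And>i. i < n \<Longrightarrow> xs i \<noteq> z"
  obtains i j l where "i < n" "j < n" "xs i \<noteq> xs j" "0 < l" "l < 1" "z = geod (xs i) (xs j) l"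
proof (cases "rad z = 0")
  case True
  then have z0: "z = t3_origin" by (simp add: rad_eq_0_iff)
  have n: "0 < n" using two_points by auto
  have r: "0 < rad (xs i)" if "i < n" for i
    using z[OF that] rad_eq_0_iff[of "xs i"] rad_nonneg[of "xs i"] z0 by (simp add: less_le)
  have "\<exists>j<n. branch (xs j) \<noteq> branch (xs 0)"
  proof (rule ccontr)
    assume "\<not> ?thesis"
    then have "branch (xs i) = branch (xs 0) \<and> 0 < rad (xs i)" if "i < n" for i
      using r that by blast
    from mle_zero_below[OF g branch_less _ _ this, of z] have "g z = 0"
      by (simp add: z0 pt_nonpos)
    then show False using gz by simp
  qed
  then obtain j where j: "j < n" "branch (xs j) \<noteq> branch (xs 0)" by blast
  let ?p = "xs 0" and ?q = "xs j"
  define l where "l = rad ?p / (rad ?p + rad ?q)"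
  have l: "0 < l" "l < 1" "l * (rad ?p + rad ?q) = rad ?p"
    using r[OF n] r[OF j(1)] by (auto simp: l_def)
  have "geod ?p ?q l = z" using j l(3) by (simp add: geod_def Let_def z0 pt_nonpos)
  then show ?thesis using that[of 0 j l] n j l by force
next
  case False
  then have rz: "0 < rad z" using rad_nonneg[of z] by linarith
  have ne: "rad (xs i) \<noteq> rad z" if "i < n" "branch (xs i) = branch z" for i
    using z[OF that(1)] that(2) pt_branch_rad by metis
  have "\<exists>i<n. branch (xs i) = branch z \<and> rad z < rad (xs i)"
  proof (rule ccontr)
    assume "\<not> ?thesis"
    then have "rad (xs i) < rad z" if "i < n" "branch (xs i) = branch z" for i
      using ne[OF that] that by force
    then show False using mle_zero_beyond[OF g rz] gz by simp
  qed
  then obtain i where i: "i < n" "branch (xs i) = branch z" "rad z < rad (xs i)" by blast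
  have "\<exists>j<n. \<not> (branch (xs j) = branch z \<and> rad z < rad (xs j))"
  proof (rule ccontr)
    assume "\<not> ?thesis"
    then have "branch (xs j) = branch z \<and> rad z < rad (xs j)" if "j < n" for j
      using that by blast
    from mle_zero_below[OF g branch_less _ _ this, of z] have "g z = 0"
      by (simp add: pt_branch_rad)
    then show False using gz by simp
  qed
  then obtain j where j: "j < n" "\<not> (branch (xs j) = branch z \<and> rad z < rad (xs j))" by blast
  let ?p = "xs i" and ?q = "xs j"
  have pq: "?p \<noteq> ?q" using i j by auto
  show ?thesis
  proof (cases "branch ?q = branch z")
    case True
    then have q: "rad ?q < rad z" using ne[OF j(1)] j by force
    define l where "l = (rad ?p - rad z) / (rad ?p - rad ?q)"
    have l: "0 < l" "l < 1" "l * (rad ?p - rad ?q) = rad ?p - rad z"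
      using i q by (auto simp: l_def)
    have "(1 - l) * rad ?p + l * rad ?q = rad z" using l(3) by (simp add: algebra_simps)
    then have "geod ?p ?q l = z" using True i by (simp add: geod_def pt_branch_rad)
    then show ?thesis using that[of i j l] i j l pq by simp
  next
    case False
    define l where "l = (rad ?p - rad z) / (rad ?p + rad ?q)"
    have pos: "0 < rad ?p + rad ?q" using i rz rad_nonneg[of ?q] by linarith
    have "rad ?p - rad z < rad ?p + rad ?q" using rz rad_nonneg[of ?q] by linarith
    then have l: "0 < l" "l < 1" using i pos by (simp_all add: l_def divide_pos_pos)
    have l3: "l * (rad ?p + rad ?q) = rad ?p - rad z" using pos by (simp add: l_def)
    have "geod ?p ?q l = z" using False i l3 rz by (simp add: geod_def Let_def pt_branch_rad)
    then show ?thesis using that[of i j l] i j l pq by simp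
  qed
qed

lemma mle_unique:
  assumes g1: "mle g1" and g2: "mle g2"
  shows "g1 = g2"
proof
  fix z
  have F: "g1 \<in> F0" "g2 \<in> F0" using assms by (auto simp: mle_def)
  show "g1 z = g2 z"
  proof (cases "\<exists>i<n. xs i = z")
    case True
    then show ?thesis using mle_unique_on_sample[OF assms] by blast
  next
    case False
    then have z: "\<And>i. i < n \<Longrightarrow> xs i \<noteq> z" by blast
    show ?thesis
    proof (cases "0 < g1 z \<or> 0 < g2 z")
      case True
      then obtain i j l where ij: "i < n" "j < n" "xs i \<noteq> xs j" "0 < l" "l < 1" "z = geod (xs i) (xs j) l"
        using mle_pos_between[OF g1 _ z] mle_pos_between[OF g2 _ z] by metis
      then show ?thesis
        using log_concave_AE_eq_geod[OF F0_log_concave[OF F(1)] F0_log_concave[OF F(2)]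
            mle_AE_unique[OF g1 g2], of "xs i" "xs j" l] mle_pos_sample[OF g1] mle_pos_sample[OF g2]
        by simp
    next
      case False
      then show ?thesis using F0_nonneg[OF F(1), of z] F0_nonneg[OF F(2), of z] by linarith
    qed
  qed
qed

lemma unique_maximiser: "\<exists>!g. g \<in> F0 \<and> (\<forall>h\<in>F0. loglik n h xs \<le> loglik n g xs)"
proof -
  have "g \<in> F0 \<and> (\<forall>h\<in>F0. loglik n h xs \<le> loglik n g xs) \<longleftrightarrow> mle g" for g
    by (auto simp: mle_def loglik_le_iff)
  then show ?thesis using mle_exists mle_unique by metis
qed

end

lemma prob_space_F0:
  assumes "f \<in> F0"
  shows "prob_space (density nu (\<lambda>x. ennreal (f x)))"
proof (rule prob_spaceI)
  have [measurable]: "f \<in> borel_measurable nu" using F0_measurable[OF assms] .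
  have "UNIV \<in> sets nu" using sets.top[of nu] by simp
  then show "emeasure (density nu (\<lambda>x. ennreal (f x))) (space (density nu (\<lambda>x. ennreal (f x)))) = 1"
    using F0_integral[OF assms] by (simp add: emeasure_density)
qed

lemma AE_PiM_rad_distinct:
  assumes f: "f \<in> F0" and "2 \<le> (n::nat)"
  shows "AE xs in PiM {..<n} (\<lambda>_. density nu (\<lambda>x. ennreal (f x))). rad (xs 0) \<noteq> rad (xs 1)"
proof -
  let ?M = "density nu (\<lambda>x. ennreal (f x))"
  have [measurable]: "f \<in> borel_measurable nu" using F0_measurable[OF f] .
  interpret M: prob_space ?M using f by (rule prob_space_F0)
  interpret P: product_sigma_finite "\<lambda>_::nat. ?M" ..
  have I: "{..<n} = insert 0 {1..<n}" using assms(2) by auto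
  have r[measurable]: "rad \<in> borel_measurable ?M" by simp
  let ?f = "\<lambda>xs. indicator {0} (rad (xs 0) - rad (xs 1)) :: ennreal"
  have c: "(\<lambda>xs. rad (xs i)) \<in> borel_measurable (PiM {..<n} (\<lambda>_. ?M))" if "i < n" for i
    using that measurable_compose[OF measurable_component_singleton[of i "{..<n}" "\<lambda>_. ?M"] r] by simp
  have m: "?f \<in> borel_measurable (PiM (insert 0 {1..<n}) (\<lambda>_. ?M))"
    using c[of 0] c[of 1] assms(2) unfolding I[symmetric] by simp
  have "(\<integral>\<^sup>+ y. ?f (xs(0 := y)) \<partial>?M) = 0" for xs :: "nat \<Rightarrow> t3"
  proof -
    have "AE y in nu. y \<notin> {x. rad x = rad (xs 1)}" using rad_fibre_null by (rule AE_not_in)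
    then have "AE y in ?M. ?f (xs(0 := y)) = 0"
      by (subst AE_density) (auto simp: indicator_def elim!: eventually_mono)
    then show ?thesis by (subst nn_integral_0_iff_AE) auto
  qed
  then have "(\<integral>\<^sup>+ xs. ?f xs \<partial>PiM (insert 0 {1..<n}) (\<lambda>_. ?M)) = 0"
    by (subst P.product_nn_integral_insert) (use m in auto)
  then have "AE xs in PiM {..<n} (\<lambda>_. ?M). ?f xs = 0"
    using m unfolding I by (subst (asm) nn_integral_0_iff_AE) auto
  then show ?thesis by eventually_elim (auto simp: indicator_def split: if_splits)
qed

theorem theorem3:
  fixes f :: "t3 \<Rightarrow> real" and n :: nat
  assumes "f \<in> F0" and "2 \<le> n"
  shows "AE xs in PiM {..<n} (\<lambda>_. density nu (\<lambda>x. ennreal (f x))).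
           \<exists>!g. g \<in> F0 \<and> (\<forall>h\<in>F0. loglik n h xs \<le> loglik n g xs)"
proof -
  let ?M = "density nu (\<lambda>x. ennreal (f x))"
  have [measurable]: "f \<in> borel_measurable nu" using F0_measurable[OF assms(1)] .
  interpret M: prob_space ?M using assms(1) by (rule prob_space_F0)
  have "AE x in ?M. 0 < f x" by (subst AE_density) auto
  then have "AE xs in PiM {..<n} (\<lambda>_. ?M). 0 < f (xs i)" if "i < n" for i
    using that by (intro AE_PiM_component M.prob_space_axioms) auto
  then have "AE xs in PiM {..<n} (\<lambda>_. ?M). \<forall>i\<in>{..<n}. 0 < f (xs i)"
    by (intro AE_finite_allI) auto
  with AE_PiM_rad_distinct[OF assms]
  show ?thesis
  proof eventually_elim
    case (elim xs)
    have "0 < lik n f xs" unfolding lik_def using elim by (intro prod_pos) auto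
    moreover have "xs 0 \<noteq> xs 1" using elim by auto
    moreover have "0 < n" "1 < n" using assms by auto
    ultimately have "sample n xs" using assms(1) unfolding sample_def by blast
    then show ?case by (rule sample.unique_maximiser)
  qed
qed

end
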